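(* Let $F:\mathbb{R}^n\rightrightarrows\mathbb{R}^n$ satisfy assumptions (F) and (H), let $\mathcal{K}\subset\mathbb{R}^n$ be closed, let $\mathcal{T}$ be the associated minimum time function, and let $x_0\in\mathcal{R}\setminus\mathcal{K}$. Let $\bar x:[0,\mathcal{T}(x_0)]\to\mathbb{R}^n$ be an optimal trajectory for $x_0$ and let $\bar p:[0,\mathcal{T}(x_0)]\to\mathbb{R}^n$ be an absolutely continuous arc such that $(\bar x,\bar p)$ is a solution of the system $$\dot x(s)=\nabla_pH(x(s),p(s)),\qquad -\dot p(s)\in\partial_xH(x(s),p(s)),\qquad\text{a.e. } s\in[0,\mathcal{T}(x_0)],$$ satisfying $\bar x(0)=x_0$ and $-\bar p(0)\in N^P_{\mathcal{R}(\mathcal{T}(x_0))}(x_0)$. Then, for all $t\in[0,\mathcal{T}(x_0)]$, $$-\bar p(t)\in N^P_{\mathcal{R}(\mathcal{T}(\bar x(t)))}(\bar x(t))\quad\text{and}\quad h(\bar x(t),-\bar p(t))=h(x_0,-\bar p(0)).$$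
   Context: Assumption (F) on a multifunction $F:\mathbb{R}^n\rightrightarrows\mathbb{R}^n$: (F1) $F(x)$ is nonempty, convex and compact for each $x\in\mathbb{R}^n$; (F2) for each compact $Q\subset\mathbb{R}^n$ there is $L>0$ with $F(x)\subset F(y)+L|y-x|\bar{\mathbb{B}}$ for all $x,y\in Q$, where $\bar{\mathbb{B}}$ is the closed unit ball; (F3) there is $\gamma>0$ with $\max\{|v|:v\in F(x)\}\le\gamma(1+|x|)$ for all $x\in\mathbb{R}^n$. Hamiltonians: $H(x,p)=\max_{v\in F(x)}\langle v,p\rangle$ and $h(x,\zeta)=\min_{v\in F(x)}\langle v,\zeta\rangle$. $\nabla_pH$ is the partial gradient in $p$; $\partial_xH(x,p)$ is Clarke's generalized gradient of $x\mapsto H(x,p)$, i.e. for a locally Lipschitz $f$, $\partial f(x)=\mathrm{co}\{v:\exists y_i\to x,\ f \text{ differentiable at } y_i,\ \nabla f(y_i)\to v\}$. Assumption (H): for every $r>0$, (H1) there exists $c\ge0$ so that for every $p\in\mathbb{S}^{n-1}$ (the unit sphere) the mapping $x\mapsto H(x,p)$ is semiconvex with semiconvexity constant $c$; (H2) $\nabla_pH(x,p)$ exists and is Lipschitz in $x$ on $B(0,r)$, uniformly for $p\in\mathbb{R}^n\setminus\{0\}$. Here a function $g$ on an open set $\Omega$ is semiconvex with constant $c$ if it is continuous and $g(x+k)+g(x-k)-2g(x)\ge-c|k|^2$ whenever $[x-k,x+k]\subset\Omega$. A trajectory of $F$ starting at $x$ is an absolutely continuous $x(\cdot)$ on $[0,T]$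 with $\dot x(t)\in F(x(t))$ for a.e. $t$ and $x(0)=x$. The minimum time function $\mathcal{T}:\mathbb{R}^n\to[0,+\infty]$ associated with the closed target $\mathcal{K}$ is $\mathcal{T}(x)=0$ if $x\in\mathcal{K}$, and otherwise $\mathcal{T}(x)=\inf\{T>0:\text{there is a trajectory } x(\cdot) \text{ of } F \text{ with } x(0)=x,\ x(T)\in\mathcal{K}\}$, with $\inf\emptyset=+\infty$. The controllable set is $\mathcal{R}=\{x:\mathcal{T}(x)<+\infty\}$, and for $t\ge0$, $\mathcal{R}(t)=\{x:\mathcal{T}(x)\le t\}$ (so $\mathcal{R}(0)=\mathcal{K}$). An optimal trajectory for $x_0\in\mathcal{R}$ is a trajectory $\bar x$ of $F$ on $[0,\mathcal{T}(x_0)]$ with $\bar x(0)=x_0$ and $\bar x(\mathcal{T}(x_0))\in\mathcal{K}$. For a closed set $E$ and $x\in E$, the proximal normal cone $N^P_E(x)$ is the set of $v$ for which there is $\sigma\ge0$ with $\langle v,y-x\rangle\le\sigma|y-x|^2$ for all $y\in E$. *)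

theory Defs
  imports "HOL-Analysis.Analysis"
begin

text \<open>The gradient is meaningful only where \<open>f\<close> is differentiable; every use below is
  accompanied by a differentiability requirement.\<close>

definition gradient :: "('a::euclidean_space \<Rightarrow> real) \<Rightarrow> 'a \<Rightarrow> 'a" where
  "gradient f x = (THE D. GDERIV f x :> D)"

lemma GDERIV_unique:
  fixes f :: "'a::euclidean_space \<Rightarrow> real"
  assumes "GDERIV f x :> D" "GDERIV f x :> E"
  shows "D = E"
proof -
  have "(\<lambda>h. h \<bullet> D) = (\<lambda>h. h \<bullet> E)"
    using assms unfolding gderiv_def by (rule has_derivative_unique)
  then have "\<forall>h. h \<bullet> D = h \<bullet> E" by metis
  then show ?thesis by (simp add: vector_eq_ldot)
qed

lemma GDERIV_iff_gradient:
  fixes f :: "'a::euclidean_space \<Rightarrow> real"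
  shows "GDERIV f x :> D \<longleftrightarrow> f differentiable (at x) \<and> gradient f x = D"
proof -
  have ex: "\<exists>D. GDERIV f x :> D" if diff: "f differentiable (at x)"
  proof -
    obtain f' where f': "(f has_derivative f') (at x)"
      using diff by (auto simp: differentiable_def)
    have "f' h = h \<bullet> adjoint f' 1" for h
      using adjoint_works[OF has_derivative_linear[OF f'], of h 1] by simp
    then have "f' = (\<lambda>h. h \<bullet> adjoint f' 1)" by auto
    then show ?thesis using f' unfolding gderiv_def by metis
  qed
  have diff: "f differentiable (at x)" if "GDERIV f x :> D" for D
    using that by (auto simp: gderiv_def differentiable_def)
  have eq: "gradient f x = D" if "GDERIV f x :> D" for D
    unfolding gradient_def using that GDERIV_unique by blast
  show ?thesis using ex diff eq by metis
qed

definition clarke_gradient :: "('a::euclidean_space \<Rightarrow> real) \<Rightarrow> 'a \<Rightarrow> 'a set" where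
  "clarke_gradient f x = convex hull {v. \<exists>y :: nat \<Rightarrow> 'a.
     y \<longlonglongrightarrow> x \<and> (\<forall>i. f differentiable (at (y i))) \<and> (\<lambda>i. gradient f (y i)) \<longlonglongrightarrow> v}"

definition semiconvex_on :: "real \<Rightarrow> 'a::euclidean_space set \<Rightarrow> ('a \<Rightarrow> real) \<Rightarrow> bool" where
  "semiconvex_on c \<Omega> g \<longleftrightarrow> continuous_on \<Omega> g \<and>
     (\<forall>x k. closed_segment (x - k) (x + k) \<subseteq> \<Omega> \<longrightarrow>
        g (x + k) + g (x - k) - 2 * g x \<ge> - c * (norm k)\<^sup>2)"

definition proximal_normal_cone :: "'a::euclidean_space set \<Rightarrow> 'a \<Rightarrow> 'a set" where
  "proximal_normal_cone E x =
     {v. \<exists>\<sigma>\<ge>0. \<forall>y\<in>E. v \<bullet> (y - x) \<le> \<sigma> * (norm (y - x))\<^sup>2}"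

text \<open>The usual \<open>\<epsilon>\<close>-\<open>\<delta>\<close> definition. A division of a set \<open>S\<close> is a finite family of nonempty
  compact intervals with pairwise disjoint interiors and union \<open>S\<close>, so \<open>D\<close> ranges over all finite
  families of non-overlapping intervals \<open>[Inf k, Sup k]\<close> contained in \<open>[a, b]\<close>.\<close>

definition absolutely_continuous_arc ::
    "real \<Rightarrow> real \<Rightarrow> (real \<Rightarrow> 'a::euclidean_space) \<Rightarrow> bool" where
  "absolutely_continuous_arc a b f \<longleftrightarrow>
     (\<forall>\<epsilon>>0. \<exists>\<delta>>0. \<forall>D S. D division_of S \<and> S \<subseteq> {a..b} \<and> (\<Sum>k\<in>D. Sup k - Inf k) < \<delta> \<longrightarrow>
        (\<Sum>k\<in>D. norm (f (Sup k) - f (Inf k))) < \<epsilon>)"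

text \<open>Under (F1) the supremum and the infimum are attained, i.e. are a maximum and a minimum.\<close>

definition max_hamiltonian :: "('a::euclidean_space \<Rightarrow> 'a set) \<Rightarrow> 'a \<Rightarrow> 'a \<Rightarrow> real" where
  "max_hamiltonian F x p = (SUP v\<in>F x. v \<bullet> p)"

definition min_hamiltonian :: "('a::euclidean_space \<Rightarrow> 'a set) \<Rightarrow> 'a \<Rightarrow> 'a \<Rightarrow> real" where
  "min_hamiltonian F x \<zeta> = (INF v\<in>F x. v \<bullet> \<zeta>)"

lemma hamiltonians_attained:
  assumes "F x \<noteq> {}" "compact (F x)"
  shows "\<exists>v\<in>F x. max_hamiltonian F x p = v \<bullet> p \<and> (\<forall>w\<in>F x. w \<bullet> p \<le> v \<bullet> p)"
    and "\<exists>v\<in>F x. min_hamiltonian F x p = v \<bullet> p \<and> (\<forall>w\<in>F x. v \<bullet> p \<le> w \<bullet> p)"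
proof -
  have cont: "continuous_on (F x) (\<lambda>v. v \<bullet> p)" by (intro continuous_intros)
  obtain v where v: "v \<in> F x" "\<forall>w\<in>F x. w \<bullet> p \<le> v \<bullet> p"
    using continuous_attains_sup[OF assms(2,1) cont] by blast
  then have "max_hamiltonian F x p = v \<bullet> p"
    unfolding max_hamiltonian_def by (intro cSup_eq_maximum) auto
  with v show "\<exists>v\<in>F x. max_hamiltonian F x p = v \<bullet> p \<and> (\<forall>w\<in>F x. w \<bullet> p \<le> v \<bullet> p)" by blast
  obtain u where u: "u \<in> F x" "\<forall>w\<in>F x. u \<bullet> p \<le> w \<bullet> p"
    using continuous_attains_inf[OF assms(2,1) cont] by blast
  then have "min_hamiltonian F x p = u \<bullet> p"
    unfolding min_hamiltonian_def by (intro cInf_eq_minimum) auto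
  with u show "\<exists>v\<in>F x. min_hamiltonian F x p = v \<bullet> p \<and> (\<forall>w\<in>F x. v \<bullet> p \<le> w \<bullet> p)" by blast
qed

definition assumption_F :: "('a::euclidean_space \<Rightarrow> 'a set) \<Rightarrow> bool" where
  "assumption_F F \<longleftrightarrow>
     (\<forall>x. F x \<noteq> {} \<and> convex (F x) \<and> compact (F x)) \<and>
     (\<forall>Q. compact Q \<longrightarrow> (\<exists>L>0. \<forall>x\<in>Q. \<forall>y\<in>Q.
        F x \<subseteq> {w + (L * norm (y - x)) *\<^sub>R b | w b. w \<in> F y \<and> b \<in> cball 0 1})) \<and>
     (\<exists>\<gamma>>0. \<forall>x. \<forall>v\<in>F x. norm v \<le> \<gamma> * (1 + norm x))"

text \<open>The radius \<open>r\<close> localizes both conditions to the ball \<open>B(0, r)\<close>; the constants \<open>c\<close> and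
  \<open>K\<close> may depend on \<open>r\<close> but not on \<open>p\<close>.\<close>

definition assumption_H :: "('a::euclidean_space \<Rightarrow> 'a set) \<Rightarrow> bool" where
  "assumption_H F \<longleftrightarrow> (\<forall>r>0.
     (\<exists>c\<ge>0. \<forall>p\<in>sphere 0 1. semiconvex_on c (ball 0 r) (\<lambda>x. max_hamiltonian F x p)) \<and>
     (\<forall>x\<in>ball 0 r. \<forall>p. p \<noteq> 0 \<longrightarrow> max_hamiltonian F x differentiable (at p)) \<and>
     (\<exists>K. \<forall>p. p \<noteq> 0 \<longrightarrow> K-lipschitz_on (ball 0 r) (\<lambda>x. gradient (max_hamiltonian F x) p)))"

definition trajectory ::
    "('a::euclidean_space \<Rightarrow> 'a set) \<Rightarrow> real \<Rightarrow> (real \<Rightarrow> 'a) \<Rightarrow> bool" where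
  "trajectory F T x \<longleftrightarrow> absolutely_continuous_arc 0 T x \<and>
     (AE s in lebesgue_on {0..T}. \<exists>v\<in>F (x s). (x has_vector_derivative v) (at s within {0..T}))"

definition min_time ::
    "('a::euclidean_space \<Rightarrow> 'a set) \<Rightarrow> 'a set \<Rightarrow> 'a \<Rightarrow> ennreal" where
  "min_time F \<K> x = (if x \<in> \<K> then 0
     else Inf {ennreal T | T. T > 0 \<and> (\<exists>y. trajectory F T y \<and> y 0 = x \<and> y T \<in> \<K>)})"

definition controllable_set :: "('a::euclidean_space \<Rightarrow> 'a set) \<Rightarrow> 'a set \<Rightarrow> 'a set" where
  "controllable_set F \<K> = {x. min_time F \<K> x < \<infinity>}"

text \<open>The time bound is an extended nonnegative real so that values of \<^const>\<open>min_time\<close> can be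
  passed to it directly.\<close>

definition reachable_set ::
    "('a::euclidean_space \<Rightarrow> 'a set) \<Rightarrow> 'a set \<Rightarrow> ennreal \<Rightarrow> 'a set" where
  "reachable_set F \<K> t = {x. min_time F \<K> x \<le> t}"

definition optimal_trajectory ::
    "('a::euclidean_space \<Rightarrow> 'a set) \<Rightarrow> 'a set \<Rightarrow> 'a \<Rightarrow> (real \<Rightarrow> 'a) \<Rightarrow> bool" where
  "optimal_trajectory F \<K> x\<^sub>0 x \<longleftrightarrow> x\<^sub>0 \<in> controllable_set F \<K> \<and>
     trajectory F (enn2real (min_time F \<K> x\<^sub>0)) x \<and>
     x 0 = x\<^sub>0 \<and> x (enn2real (min_time F \<K> x\<^sub>0)) \<in> \<K>"

definition hamiltonian_system_solution ::
    "('a::euclidean_space \<Rightarrow> 'a set) \<Rightarrow> real \<Rightarrow> (real \<Rightarrow> 'a) \<Rightarrow> (real \<Rightarrow> 'a) \<Rightarrow> bool" where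
  "hamiltonian_system_solution F T x p \<longleftrightarrow>
     absolutely_continuous_arc 0 T x \<and> absolutely_continuous_arc 0 T p \<and>
     (AE s in lebesgue_on {0..T}.
        max_hamiltonian F (x s) differentiable (at (p s)) \<and>
        (x has_vector_derivative gradient (max_hamiltonian F (x s)) (p s)) (at s within {0..T}) \<and>
        (\<exists>p'. (p has_vector_derivative p') (at s within {0..T}) \<and>
           - p' \<in> clarke_gradient (\<lambda>y. max_hamiltonian F y (p s)) (x s)))"

end

theory Submission
  imports Defs
begin

text \<open>Let \<open>z\<close> be a point of the sublevel set near \<open>x t\<close>. Because \<open>\<nabla>\<^sub>pH\<close> is Lipschitz in the state, the equation
  \<open>y' = \<nabla>\<^sub>pH(y, p)\<close>, \<open>y t = z\<close> can be solved backwards, and its solution is a trajectory of \<open>F\<close> with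
  \<open>norm (y - x) \<le> C * norm (z - x t)\<close>. By optimality of \<open>x\<close> the point \<open>y 0\<close> lies in the sublevel set of
  \<open>x 0\<close>. As \<open>- p'\<close> is a Clarke gradient of the semiconvex function \<open>H(\<cdot>, p)\<close>, the derivative of
  \<open>p \<bullet> (y - x)\<close>, which is \<open>p' \<bullet> (y - x) + H(y, p) - H(x, p)\<close>, is at least \<open>- C * (norm (y - x))\<^sup>2\<close>;
  hence the proximal inequality at time \<open>0\<close> carries over to time \<open>t\<close>.

  Semiconvexity in \<open>x\<close> and convexity in \<open>p\<close> bound \<open>H(x u, p u) - H(x s, p s)\<close> from below by
  \<open>o(u - s)\<close> for \<open>u\<close> on both sides of almost every \<open>s\<close>, so the Hamiltonian, which is absolutely
  continuous along the arc, is both nondecreasing and nonincreasing. If \<open>p\<close> vanishes somewhere then it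
  vanishes everywhere, by Gronwall's inequality, and the claim is trivial.\<close>

section \<open>Absolutely continuous arcs\<close>

lemma division_of_real_interval:
  fixes D :: "real set set"
  assumes "D division_of S" "S \<subseteq> {a..b}" "k \<in> D"
  shows "\<exists>u v. k = {u..v} \<and> a \<le> u \<and> u \<le> v \<and> v \<le> b"
proof -
  obtain u v where k: "k = cbox u v" using assms division_ofD(4) by blast
  have "k \<noteq> {}" "k \<subseteq> {a..b}" using assms division_ofD(2,3) by blast+
  then have "u \<in> k" "v \<in> k" using k by auto
  then show ?thesis using k \<open>k \<subseteq> {a..b}\<close> by (intro exI[of _ u] exI[of _ v]) auto
qed

lemma absolutely_continuous_arcE:
  assumes "absolutely_continuous_arc a b f" "e > 0"
  obtains \<delta> where "\<delta> > 0"
    "\<And>D S. D division_of S \<and> S \<subseteq> {a..b} \<and> (\<Sum>k\<in>D. Sup k - Inf k) < \<delta> \<Longrightarrow>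
      (\<Sum>k\<in>D. norm (f (Sup k) - f (Inf k))) < e"
proof -
  from assms obtain \<delta> where "\<delta> > 0" and
    *: "\<forall>D S. D division_of S \<and> S \<subseteq> {a..b} \<and> (\<Sum>k\<in>D. Sup k - Inf k) < \<delta> \<longrightarrow>
      (\<Sum>k\<in>D. norm (f (Sup k) - f (Inf k))) < e"
    unfolding absolutely_continuous_arc_def by meson
  then show thesis by (intro that[OF \<open>\<delta> > 0\<close>]) blast
qed

text \<open>Absolute continuity sees an arc only through its increments over intervals, so control
  of the increments suffices. Sums, products and the Hamiltonian along an arc all reduce to this
  criterion.\<close>

lemma absolutely_continuous_arc_dominated:
  assumes f: "absolutely_continuous_arc a b f" and g: "absolutely_continuous_arc a b g"
    and dom: "\<And>s t. s \<in> {a..b} \<Longrightarrow> t \<in> {a..b} \<Longrightarrow> s \<le> t \<Longrightarrow>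
      norm (h t - h s) \<le> K * norm (f t - f s) + M * norm (g t - g s)"
  shows "absolutely_continuous_arc a b h"
  unfolding absolutely_continuous_arc_def
proof (intro allI impI)
  fix e :: real assume e: "e > 0"
  \<comment> \<open>\<open>K\<close> and \<open>M\<close> may have any sign; strictly positive
    majorants make the tolerances \<open>e / (2 * K')\<close> and \<open>e / (2 * M')\<close>
    meaningful.\<close>
  define K' where "K' = \<bar>K\<bar> + 1"
  define M' where "M' = \<bar>M\<bar> + 1"
  have pos: "K' > 0" "M' > 0" by (auto simp: K'_def M'_def)
  obtain d1 where d1: "d1 > 0" "\<And>D S. D division_of S \<and> S \<subseteq> {a..b} \<and> (\<Sum>k\<in>D. Sup k - Inf k) < d1 \<Longrightarrow>
        (\<Sum>k\<in>D. norm (f (Sup k) - f (Inf k))) < e / (2 * K')"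
    by (rule absolutely_continuous_arcE[OF f, of "e / (2 * K')"]) (use e pos in auto)
  obtain d2 where d2: "d2 > 0" "\<And>D S. D division_of S \<and> S \<subseteq> {a..b} \<and> (\<Sum>k\<in>D. Sup k - Inf k) < d2 \<Longrightarrow>
        (\<Sum>k\<in>D. norm (g (Sup k) - g (Inf k))) < e / (2 * M')"
    by (rule absolutely_continuous_arcE[OF g, of "e / (2 * M')"]) (use e pos in auto)
  show "\<exists>\<delta>>0. \<forall>D S. D division_of S \<and> S \<subseteq> {a..b} \<and> (\<Sum>k\<in>D. Sup k - Inf k) < \<delta> \<longrightarrow>
        (\<Sum>k\<in>D. norm (h (Sup k) - h (Inf k))) < e"
  proof (intro exI[of _ "min d1 d2"] conjI allI impI)
    show "min d1 d2 > 0" using d1 d2 by auto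
    fix D S assume *: "D division_of S \<and> S \<subseteq> {a..b} \<and> (\<Sum>k\<in>D. Sup k - Inf k) < min d1 d2"
    have 1: "(\<Sum>k\<in>D. norm (f (Sup k) - f (Inf k))) < e / (2 * K')" using d1(2)[of D S] * by auto
    have 2: "(\<Sum>k\<in>D. norm (g (Sup k) - g (Inf k))) < e / (2 * M')" using d2(2)[of D S] * by auto
    have "(\<Sum>k\<in>D. norm (h (Sup k) - h (Inf k))) \<le>
        (\<Sum>k\<in>D. K' * norm (f (Sup k) - f (Inf k)) + M' * norm (g (Sup k) - g (Inf k)))"
    proof (rule sum_mono)
      fix k assume "k \<in> D"
      then obtain u v where uv: "k = {u..v}" "a \<le> u" "u \<le> v" "v \<le> b"
        using * division_of_real_interval[of D S a b k] by blast
      have "norm (h v - h u) \<le> K * norm (f v - f u) + M * norm (g v - g u)"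
        using dom[of u v] uv by auto
      also have "\<dots> \<le> K' * norm (f v - f u) + M' * norm (g v - g u)"
        unfolding K'_def M'_def by (intro add_mono mult_right_mono) auto
      finally show "norm (h (Sup k) - h (Inf k)) \<le> K' * norm (f (Sup k) - f (Inf k)) + M' * norm (g (Sup k) - g (Inf k))"
        using uv by auto
    qed
    also have "\<dots> = K' * (\<Sum>k\<in>D. norm (f (Sup k) - f (Inf k))) + M' * (\<Sum>k\<in>D. norm (g (Sup k) - g (Inf k)))"
      by (simp add: sum.distrib sum_distrib_left)
    also have "\<dots> < K' * (e / (2 * K')) + M' * (e / (2 * M'))"
      using 1 2 pos by (intro add_strict_mono mult_strict_left_mono) auto
    also have "\<dots> = e" using pos by (simp add: field_simps)
    finally show "(\<Sum>k\<in>D. norm (h (Sup k) - h (Inf k))) < e" .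
  qed
qed

lemma absolutely_continuous_arc_ident: "absolutely_continuous_arc a b (\<lambda>s. s)"
  unfolding absolutely_continuous_arc_def
proof (intro allI impI)
  fix e :: real assume e: "e > 0"
  have "(\<Sum>k\<in>D. norm (Sup k - Inf k)) < e"
    if D0: "D division_of S \<and> S \<subseteq> {a..b} \<and> (\<Sum>k\<in>D. Sup k - Inf k) < e" for D S
  proof -
    have "(\<Sum>k\<in>D. norm (Sup k - Inf k)) = (\<Sum>k\<in>D. Sup k - Inf k)"
    proof (rule sum.cong)
      fix k assume "k \<in> D"
      then obtain u v where "k = {u..v}" "u \<le> v" using \<open>k \<in> D\<close> division_of_real_interval[of D S a b k] D0 by blast
      then show "norm (Sup k - Inf k) = Sup k - Inf k" by auto
    qed simp
    then show ?thesis using D0 by auto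
  qed
  then show "\<exists>\<delta>>0. \<forall>D S. D division_of S \<and> S \<subseteq> {a..b} \<and> (\<Sum>k\<in>D. Sup k - Inf k) < \<delta> \<longrightarrow>
        (\<Sum>k\<in>D. norm (Sup k - Inf k)) < e" using e by blast
qed

lemma absolutely_continuous_arc_dominated1:
  assumes f: "absolutely_continuous_arc a b f"
    and dom: "\<And>s t. s \<in> {a..b} \<Longrightarrow> t \<in> {a..b} \<Longrightarrow> s \<le> t \<Longrightarrow> norm (h t - h s) \<le> K * norm (f t - f s)"
  shows "absolutely_continuous_arc a b h"
  using dom by (intro absolutely_continuous_arc_dominated[OF f f, of h K 0]) auto

lemma lipschitz_imp_absolutely_continuous_arc:
  fixes f :: "real \<Rightarrow> 'a::euclidean_space"
  assumes "K-lipschitz_on {a..b} f"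
  shows "absolutely_continuous_arc a b f"
  by (intro absolutely_continuous_arc_dominated1[OF absolutely_continuous_arc_ident, of a b f K])
     (use lipschitz_onD[OF assms] in \<open>fastforce simp: dist_norm\<close>)

lemma absolutely_continuous_arc_add:
  assumes "absolutely_continuous_arc a b f" "absolutely_continuous_arc a b g"
  shows "absolutely_continuous_arc a b (\<lambda>s. f s + g s)"
  using norm_triangle_ineq
  by (intro absolutely_continuous_arc_dominated[OF assms, of _ 1 1]) (simp add: add_diff_add)

lemma absolutely_continuous_arc_diff:
  assumes "absolutely_continuous_arc a b f" "absolutely_continuous_arc a b g"
  shows "absolutely_continuous_arc a b (\<lambda>s. f s - g s)"
proof (rule absolutely_continuous_arc_dominated[OF assms, of _ 1 1])
  fix s t
  have "f t - g t - (f s - g s) = (f t - f s) - (g t - g s)" by simp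
  then show "norm (f t - g t - (f s - g s)) \<le> 1 * norm (f t - f s) + 1 * norm (g t - g s)"
    using norm_triangle_ineq4[of "f t - f s" "g t - g s"] by (simp only: mult_1)
qed

text \<open>A single interval is already a division, so the definition contains a modulus of
  continuity.\<close>

lemma absolutely_continuous_arc_imp_continuous_on:
  fixes f :: "real \<Rightarrow> 'a::euclidean_space"
  assumes f: "absolutely_continuous_arc a b f"
  shows "continuous_on {a..b} f"
  unfolding continuous_on_iff
proof (intro ballI allI impI)
  fix s and e :: real assume s: "s \<in> {a..b}" and e: "e > 0"
  obtain d where d: "d > 0" "\<And>D S. D division_of S \<and> S \<subseteq> {a..b} \<and> (\<Sum>k\<in>D. Sup k - Inf k) < d \<Longrightarrow>
        (\<Sum>k\<in>D. norm (f (Sup k) - f (Inf k))) < e"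
    by (rule absolutely_continuous_arcE[OF f e]) auto
  have *: "dist (f v) (f u) < e" if "u \<in> {a..b}" "v \<in> {a..b}" "u \<le> v" "dist v u < d" for u v
    using d(2)[of "{{u..v}}" "{u..v}"] that division_of_self[of u v]
    by (auto simp: dist_norm)
  show "\<exists>d>0. \<forall>x'\<in>{a..b}. dist x' s < d \<longrightarrow> dist (f x') (f s) < e"
    using d(1) *[of s] *[of _ s] s by (metis dist_commute linear)
qed

text \<open>Both arcs are bounded on the compact interval, so the product rule for increments yields
  a domination.\<close>

lemma absolutely_continuous_arc_inner:
  fixes f g :: "real \<Rightarrow> 'a::euclidean_space"
  assumes f: "absolutely_continuous_arc a b f" and g: "absolutely_continuous_arc a b g"
  shows "absolutely_continuous_arc a b (\<lambda>s. f s \<bullet> g s)"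
proof -
  have "bounded (f ` {a..b})" "bounded (g ` {a..b})"
    by (intro compact_imp_bounded compact_continuous_image absolutely_continuous_arc_imp_continuous_on f g compact_Icc)+
  then obtain A B where A: "\<And>s. s \<in> {a..b} \<Longrightarrow> norm (f s) \<le> A" and B: "\<And>s. s \<in> {a..b} \<Longrightarrow> norm (g s) \<le> B"
    unfolding bounded_iff by blast
  show ?thesis
  proof (rule absolutely_continuous_arc_dominated[OF f g, of _ B A])
    fix s t assume st: "s \<in> {a..b}" "t \<in> {a..b}"
    have "f t \<bullet> g t - f s \<bullet> g s = (f t - f s) \<bullet> g t + f s \<bullet> (g t - g s)"
      by (simp add: algebra_simps)
    also have "norm \<dots> \<le> norm (f t - f s) * norm (g t) + norm (f s) * norm (g t - g s)"
      by (intro norm_triangle_le add_mono) (auto simp: Cauchy_Schwarz_ineq2)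
    also have "\<dots> \<le> norm (f t - f s) * B + A * norm (g t - g s)"
      using A B st by (intro add_mono mult_left_mono mult_right_mono) auto
    finally show "norm (f t \<bullet> g t - f s \<bullet> g s) \<le> B * norm (f t - f s) + A * norm (g t - g s)"
      by (simp add: mult.commute)
  qed
qed

lemma has_vector_derivative_bounded_imp_lipschitz:
  fixes f :: "real \<Rightarrow> 'a::euclidean_space"
  assumes f: "\<And>s. s \<in> {a..b} \<Longrightarrow> (f has_vector_derivative f' s) (at s within {a..b})"
    and f': "\<And>s. s \<in> {a..b} \<Longrightarrow> norm (f' s) \<le> B"
    and "0 \<le> B"
  shows "B-lipschitz_on {a..b} f"
proof (rule bounded_derivative_imp_lipschitz)
  fix s assume "s \<in> {a..b}"
  then show "(f has_derivative (\<lambda>h. h *\<^sub>R f' s)) (at s within {a..b})"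
    using f by (auto simp: has_vector_derivative_def)
  show "onorm (\<lambda>h. h *\<^sub>R f' s) \<le> B"
    using f'[OF \<open>s \<in> {a..b}\<close>] by (intro onorm_bound \<open>0 \<le> B\<close>) (auto simp: mult.commute[of B] mult_left_mono)
qed (use assms in auto)

lemma C1_imp_absolutely_continuous_arc:
  fixes f :: "real \<Rightarrow> 'a::euclidean_space"
  assumes f: "\<And>s. s \<in> {a..b} \<Longrightarrow> (f has_vector_derivative f' s) (at s within {a..b})"
    and f': "continuous_on {a..b} f'"
  shows "absolutely_continuous_arc a b f"
proof -
  have "bounded (f' ` {a..b})"
    by (intro compact_imp_bounded compact_continuous_image f' compact_Icc)
  then obtain B where "B > 0" "\<And>s. s \<in> {a..b} \<Longrightarrow> norm (f' s) \<le> B"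
    unfolding bounded_pos by blast
  then show ?thesis
    using has_vector_derivative_bounded_imp_lipschitz[OF f] lipschitz_imp_absolutely_continuous_arc
    by (metis less_imp_le)
qed

text \<open>The images under \<open>m\<close> of two distinct members of a division coincide only if both are
  degenerate, so they form a division of total length no larger.\<close>

lemma absolutely_continuous_arc_compose:
  fixes f :: "real \<Rightarrow> 'a::euclidean_space" and m :: "real \<Rightarrow> real"
  assumes f: "absolutely_continuous_arc a b f"
    and m: "m ` {c..d} \<subseteq> {a..b}" "1-lipschitz_on {c..d} m"
    and mono: "mono_on {c..d} m \<or> antimono_on {c..d} m"
  shows "absolutely_continuous_arc c d (\<lambda>s. f (m s))"
  unfolding absolutely_continuous_arc_def
proof (intro allI impI)
  fix e :: real assume e: "e > 0"
  obtain \<delta> where \<delta>: "\<delta> > 0" "\<And>D S. D division_of S \<and> S \<subseteq> {a..b} \<and> (\<Sum>k\<in>D. Sup k - Inf k) < \<delta> \<Longrightarrow>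
        (\<Sum>k\<in>D. norm (f (Sup k) - f (Inf k))) < e"
    by (rule absolutely_continuous_arcE[OF f e]) auto
  \<comment> \<open>The interval spanned by the images of the endpoints; \<open>min\<close> and
    \<open>max\<close> treat increasing and decreasing \<open>m\<close> alike.\<close>
  define I where "I k = {min (m (Inf k)) (m (Sup k)) .. max (m (Inf k)) (m (Sup k))}" for k
  show "\<exists>\<delta>>0. \<forall>D S. D division_of S \<and> S \<subseteq> {c..d} \<and> (\<Sum>k\<in>D. Sup k - Inf k) < \<delta> \<longrightarrow>
        (\<Sum>k\<in>D. norm (f (m (Sup k)) - f (m (Inf k)))) < e"
  proof (intro exI[of _ \<delta>] conjI allI impI \<delta>(1))
    fix D S assume D: "D division_of S \<and> S \<subseteq> {c..d} \<and> (\<Sum>k\<in>D. Sup k - Inf k) < \<delta>"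
    have fin: "finite D" using D by auto
    have k: "\<exists>u v. k = {u..v} \<and> c \<le> u \<and> u \<le> v \<and> v \<le> d" if "k \<in> D" for k
      using D that division_of_real_interval[of D S c d k] by blast
    have disj: "interior (I k) \<inter> interior (I l) = {}" if kl: "k \<in> D" "l \<in> D" "k \<noteq> l" for k l
    proof -
      obtain u v where uv: "k = {u..v}" "c \<le> u" "u \<le> v" "v \<le> d" using k kl by metis
      obtain u' v' where uv': "l = {u'..v'}" "c \<le> u'" "u' \<le> v'" "v' \<le> d" using k kl by metis
      have "interior k \<inter> interior l = {}" using D kl by blast
      then have "{u<..<v} \<inter> {u'<..<v'} = {}" using uv uv' by simp
      then have "{max u u'<..<min v v'} = {}" by auto
      \<comment> \<open>Disjoint interiors leave four cases: one of the intervals is a single point,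
        or one lies entirely before the other.\<close>
      then have c: "u = v \<or> u' = v' \<or> v \<le> u' \<or> v' \<le> u" using uv uv' 
        by (auto simp: greaterThanLessThan_empty_iff)
      have mm: "(m u \<le> m v \<and> m u' \<le> m v' \<and> (v \<le> u' \<longrightarrow> m v \<le> m u') \<and> (v' \<le> u \<longrightarrow> m v' \<le> m u)) \<or>
            (m u \<ge> m v \<and> m u' \<ge> m v' \<and> (v \<le> u' \<longrightarrow> m v \<ge> m u') \<and> (v' \<le> u \<longrightarrow> m v' \<ge> m u))"
        using mono uv uv' unfolding monotone_on_def by auto
      show ?thesis using c mm uv uv' unfolding I_def by (auto simp: min_def max_def split: if_splits)
    qed
    \<comment> \<open>A shared image has an interior disjoint from itself, hence is a point. Such
      members contribute zero to the sums, which permits reindexing along \<open>I\<close> without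
      injectivity.\<close>
    have eq0: "Inf (I k) = Sup (I k) \<and> m (Inf k) = m (Sup k)" if kl: "k \<in> D" "l \<in> D" "k \<noteq> l" "I k = I l" for k l
    proof -
      have "interior (I k) = {}" using disj[OF kl(1-3)] kl(4) by auto
      then show ?thesis unfolding I_def by (auto simp: min_def max_def split: if_splits)
    qed
    have div: "I ` D division_of (\<Union>(I ` D))"
    proof (rule division_ofI)
      fix K assume "K \<in> I ` D"
      then show "K \<noteq> {}" "\<exists>a b. K = cbox a b" "K \<subseteq> \<Union>(I ` D)" by (auto simp: I_def)
    next
      fix K L assume "K \<in> I ` D" "L \<in> I ` D" "K \<noteq> L"
      then show "interior K \<inter> interior L = {}" using disj by blast
    qed (use fin in auto)
    have sub: "\<Union>(I ` D) \<subseteq> {a..b}"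
    proof
      fix s assume "s \<in> \<Union>(I ` D)"
      then obtain l where l: "l \<in> D" "s \<in> I l" by blast
      obtain u v where uv: "l = {u..v}" "c \<le> u" "u \<le> v" "v \<le> d" using k l by metis
      have "m u \<in> {a..b}" "m v \<in> {a..b}" using subsetD[OF m(1)] uv by auto
      then show "s \<in> {a..b}" using l(2) uv by (auto simp: I_def)
    qed
    have "(\<Sum>k\<in>I ` D. Sup k - Inf k) = (\<Sum>k\<in>D. Sup (I k) - Inf (I k))"
      using eq0 by (subst sum.reindex_nontrivial[OF fin]) auto
    also have "\<dots> \<le> (\<Sum>k\<in>D. Sup k - Inf k)"
    proof (rule sum_mono)
      fix l assume "l \<in> D"
      then obtain u v where uv: "l = {u..v}" "c \<le> u" "u \<le> v" "v \<le> d" using k by metis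
      then have "\<bar>m u - m v\<bar> \<le> v - u" using lipschitz_onD[OF m(2), of u v] by (auto simp: dist_real_def)
      then show "Sup (I l) - Inf (I l) \<le> Sup l - Inf l" using uv by (auto simp: I_def)
    qed
    finally have "(\<Sum>k\<in>I ` D. norm (f (Sup k) - f (Inf k))) < e"
      using \<delta>(2)[of "I ` D"] div sub D by auto
    also have "(\<Sum>k\<in>I ` D. norm (f (Sup k) - f (Inf k))) = (\<Sum>k\<in>D. norm (f (Sup (I k)) - f (Inf (I k))))"
    proof -
      have "norm (f (Sup (I k)) - f (Inf (I k))) = 0" if "k \<in> D" "l \<in> D" "k \<noteq> l" "I k = I l" for k l
        using eq0[OF that] by simp
      then show ?thesis by (subst sum.reindex_nontrivial[OF fin]) auto
    qed
    also have "\<dots> = (\<Sum>k\<in>D. norm (f (m (Sup k)) - f (m (Inf k))))"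
      by (rule sum.cong) (auto simp: I_def min_def max_def norm_minus_commute)
    finally show "(\<Sum>k\<in>D. norm (f (m (Sup k)) - f (m (Inf k)))) < e" .
  qed
qed

section \<open>Shifted, reflected and glued arcs\<close>

lemma absolutely_continuous_arc_shift:
  fixes f :: "real \<Rightarrow> 'a::euclidean_space"
  assumes "absolutely_continuous_arc a b f" "a \<le> c + h" "d + h \<le> b"
  shows "absolutely_continuous_arc c d (\<lambda>s. f (s + h))"
proof (rule absolutely_continuous_arc_compose[OF assms(1)])
  show "1-lipschitz_on {c..d} (\<lambda>s. s + h)" by (rule lipschitz_onI) (auto simp: dist_real_def)
qed (use assms in \<open>auto simp: monotone_on_def\<close>)

lemma absolutely_continuous_arc_subinterval:
  fixes f :: "real \<Rightarrow> 'a::euclidean_space"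
  assumes "absolutely_continuous_arc a b f" "a \<le> c" "d \<le> b"
  shows "absolutely_continuous_arc c d f"
  using absolutely_continuous_arc_shift[OF assms(1), of c 0 d] assms by simp

lemma absolutely_continuous_arc_reflect:
  fixes f :: "real \<Rightarrow> 'a::euclidean_space"
  assumes "absolutely_continuous_arc a b f"
  shows "absolutely_continuous_arc (- b) (- a) (\<lambda>s. f (- s))"
proof (rule absolutely_continuous_arc_compose[OF assms(1)])
  show "1-lipschitz_on {- b..- a} (uminus :: real \<Rightarrow> real)" by (rule lipschitz_onI) (auto simp: dist_real_def)
qed (use assms in \<open>auto simp: monotone_on_def\<close>)

lemma absolutely_continuous_arc_join:
  fixes f g :: "real \<Rightarrow> 'a::euclidean_space"
  assumes f: "absolutely_continuous_arc 0 t f" and g: "absolutely_continuous_arc 0 u g"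
    and "0 \<le> t" "0 \<le> u" and fg: "f t = g 0"
  shows "absolutely_continuous_arc 0 (t + u) (\<lambda>s. if s \<le> t then f s else g (s - t))"
proof -
  have 1: "absolutely_continuous_arc 0 (t + u) (\<lambda>s. f (min s t))"
  proof (rule absolutely_continuous_arc_compose[OF f])
    show "1-lipschitz_on {0..t + u} (\<lambda>s. min s t)" by (rule lipschitz_onI) (auto simp: dist_real_def)
  qed (use assms in \<open>auto simp: monotone_on_def\<close>)
  have 2: "absolutely_continuous_arc 0 (t + u) (\<lambda>s. g (max 0 (s - t)))"
  proof (rule absolutely_continuous_arc_compose[OF g])
    show "1-lipschitz_on {0..t + u} (\<lambda>s. max 0 (s - t))" by (rule lipschitz_onI) (auto simp: dist_real_def)
  qed (use assms in \<open>auto simp: monotone_on_def\<close>)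
  \<comment> \<open>Freezing each parameter outside its own range turns gluing into a sum of two
    reparametrized arcs minus the common value at the junction; no division has to be cut at
    \<open>t\<close>.\<close>
  have eq: "(if s \<le> t then f s else g (s - t)) = f (min s t) + g (max 0 (s - t)) - g 0" for s
    using fg by (auto simp: min_def max_def)
  have 3: "absolutely_continuous_arc 0 (t + u) (\<lambda>s. g 0)"
    by (rule lipschitz_imp_absolutely_continuous_arc[of 0]) (auto intro!: lipschitz_onI)
  show ?thesis unfolding eq
    by (intro absolutely_continuous_arc_diff absolutely_continuous_arc_add 1 2 3)
qed

section \<open>Monotonicity from Dini derivatives\<close>

text \<open>Outside \<open>N\<close> the function climbs by the Dini condition. The increments inside an open cover
  \<open>U\<close> of \<open>N\<close> are charged to the variation \<open>V\<close> over \<open>U\<close>, which is small by absolute continuity.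
  Using \<open>V\<close> instead of one division keeps the set of good points closed under limits.\<close>

lemma absolutely_continuous_arc_increasing_Dini:
  fixes \<phi> :: "real \<Rightarrow> real"
  assumes ac: "absolutely_continuous_arc a b \<phi>" and "a \<le> b" and N: "negligible N"
    and Dini: "\<And>s e. s \<in> {a<..<b} - N \<Longrightarrow> e > 0 \<Longrightarrow>
      \<exists>d>0. \<forall>t\<in>{s<..<s + d}. t \<le> b \<longrightarrow> \<phi> t \<ge> \<phi> s - e * (t - s)"
  shows "\<phi> a \<le> \<phi> b"
proof (rule field_le_epsilon)
  fix e' :: real assume "e' > 0"
  \<comment> \<open>The final loss is \<open>e * (b - a)\<close> from the Dini condition plus
    \<open>e\<close> from the cover; this choice makes it \<open>e'\<close>.\<close>
  define e where "e = e' / (b - a + 1)"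
  have e: "e > 0" using \<open>e' > 0\<close> \<open>a \<le> b\<close> by (simp add: e_def)
  obtain \<delta> where \<delta>: "\<delta> > 0" "\<And>D S. D division_of S \<and> S \<subseteq> {a..b} \<and> (\<Sum>k\<in>D. Sup k - Inf k) < \<delta> \<Longrightarrow>
        (\<Sum>k\<in>D. norm (\<phi> (Sup k) - \<phi> (Inf k))) < e"
    by (rule absolutely_continuous_arcE[OF ac e]) auto
  \<comment> \<open>The endpoints join the exceptional set, so that a point of the interval outside
    \<open>U\<close> is interior and the Dini condition applies to it.\<close>
  have N': "negligible (N \<union> {a, b})" using N by (simp add: negligible_Un)
  obtain U where U: "open U" "N \<union> {a, b} \<subseteq> U" "U \<in> lmeasurable" "measure lebesgue U < \<delta>"
  proof -
    have "N \<union> {a, b} \<in> sets lebesgue" using N' by (rule negligible_imp_sets)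
    then obtain U where U: "open U" "N \<union> {a, b} \<subseteq> U" "U - (N \<union> {a, b}) \<in> lmeasurable"
        "emeasure lebesgue (U - (N \<union> {a, b})) < ennreal \<delta>"
      using sets_lebesgue_outer_open[OF _ \<delta>(1)] by metis
    have "(U - (N \<union> {a, b})) \<union> (N \<union> {a, b}) = U" using U(2) by blast
    then have "U \<in> lmeasurable" "measure lebesgue U = measure lebesgue (U - (N \<union> {a, b}))"
      using fmeasurable.Un[OF U(3) negligible_imp_measurable[OF N']]
        measure_Un_null_set[of "U - (N \<union> {a, b})" lebesgue "N \<union> {a, b}"] U(3) N'
      by (simp_all only: negligible_iff_null_sets fmeasurableD)
    then show thesis using that[of U] U \<delta>(1)
      by (simp add: emeasure_eq_measure2 ennreal_less_iff)
  qed
  define W where "W c = {\<Sum>k\<in>D. norm (\<phi> (Sup k) - \<phi> (Inf k)) | D S. D division_of S \<and> S \<subseteq> U \<inter> {a..c}}" for c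
  define V where "V c = Sup (W c)" for c
  \<comment> \<open>A division inside \<open>U\<close> has total length at most the measure of
    \<open>U\<close>, which is below \<open>\<delta>\<close>, so absolute continuity caps every
    variation sum by \<open>e\<close>.\<close>
  have bnd: "r \<le> e" if r: "r \<in> W c" and "c \<le> b" for r c
  proof -
    obtain D S where D: "D division_of S" "S \<subseteq> U \<inter> {a..c}" 
      and r: "r = (\<Sum>k\<in>D. norm (\<phi> (Sup k) - \<phi> (Inf k)))"
      using r unfolding W_def by blast
    have "(\<Sum>k\<in>D. Sup k - Inf k) = (\<Sum>k\<in>D. measure lebesgue k)"
    proof (rule sum.cong)
      fix k assume "k \<in> D"
      then obtain u v where "k = {u..v}" "u \<le> v" using division_of_real_interval[OF D(1), of a c k] D(2) by blast
      then show "Sup k - Inf k = measure lebesgue k" by simp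
    qed simp
    also have "\<dots> = measure lebesgue S" using D(1) by (rule content_division)
    also have "\<dots> \<le> measure lebesgue U"
      using D U by (intro measure_mono_fmeasurable) (auto intro: fmeasurableD lmeasurable_division)
    also have "\<dots> < \<delta>" by fact
    finally show ?thesis using \<delta>(2)[of D S] D \<open>c \<le> b\<close> unfolding r by force
  qed
  have bdd: "bdd_above (W c)" if "c \<le> b" for c using bnd that by (meson bdd_aboveI)
  have zero: "0 \<in> W c" for c
    unfolding W_def by (rule CollectI, rule exI[of _ "{}"], rule exI[of _ "{}"]) simp
  have W_mono: "W c \<subseteq> W d" if "c \<le> d" for c d
  proof
    fix r assume "r \<in> W c"
    then obtain D S where "D division_of S" "S \<subseteq> U \<inter> {a..c}" "r = (\<Sum>k\<in>D. norm (\<phi> (Sup k) - \<phi> (Inf k)))"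
      unfolding W_def by blast
    moreover have "{a..c} \<subseteq> {a..d}" using that by simp
    ultimately show "r \<in> W d" unfolding W_def by blast
  qed
  have V_mono: "V c \<le> V d" if "c \<le> d" "d \<le> b" for c d
    unfolding V_def using zero[of c] by (intro cSup_subset_mono bdd W_mono that) auto
  have V_le: "V c \<le> e" if "c \<le> b" for c
    unfolding V_def using zero bnd that by (intro cSup_least) auto
  have V_nonneg: "0 \<le> V c" if "c \<le> b" for c
    unfolding V_def using zero bdd[OF that] by (rule cSup_upper)
  \<comment> \<open>An interval inside \<open>U\<close> can be appended to any division lying to its
    left. Hence \<open>V\<close> pays for whatever \<open>\<phi>\<close> does across that
    interval.\<close>
  have V_add: "V c + \<bar>\<phi> d - \<phi> c\<bar> \<le> V d" if cd: "a \<le> c" "c < d" "d \<le> b" and sub: "{c..d} \<subseteq> U" for c d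
  proof -
    have "r + \<bar>\<phi> d - \<phi> c\<bar> \<le> V d" if r: "r \<in> W c" for r
    proof -
      obtain D S where D: "D division_of S" "S \<subseteq> U \<inter> {a..c}" 
        and r: "r = (\<Sum>k\<in>D. norm (\<phi> (Sup k) - \<phi> (Inf k)))"
        using r unfolding W_def by blast
      have new: "{c..d} \<notin> D"
      proof
        assume "{c..d} \<in> D"
        then have "{c..d} \<subseteq> {a..c}" using D division_ofD(2) by blast
        then have "d \<in> {a..c}" using cd by auto
        then show False using cd by auto
      qed
      have i1: "insert {c..d} D division_of ({c..d} \<union> S)"
      proof -
        have "{{c..d}} division_of {c..d}" using division_of_self[of c d] cd by auto
        moreover have "interior {c..d} \<inter> interior S = {}"
        proof -
          have "interior S \<subseteq> interior {a..c}" using D by (intro interior_mono) auto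
          then show ?thesis by auto
        qed
        ultimately show ?thesis using division_disjoint_union[of "{{c..d}}" "{c..d}" D S] D by simp
      qed
      have i2: "{c..d} \<union> S \<subseteq> U \<inter> {a..d}" using D cd sub by auto
      have i3: "(\<Sum>k\<in>insert {c..d} D. norm (\<phi> (Sup k) - \<phi> (Inf k))) = r + \<bar>\<phi> d - \<phi> c\<bar>"
        using new division_of_finite[OF D(1)] cd by (simp add: r)
      have "r + \<bar>\<phi> d - \<phi> c\<bar> \<in> W d" unfolding W_def
        by (intro CollectI exI[of _ "insert {c..d} D"] exI[of _ "{c..d} \<union> S"] conjI i1 i2 i3[symmetric])
      then show ?thesis unfolding V_def using bdd cd by (intro cSup_upper) auto
    qed
    then have "V c \<le> V d - \<bar>\<phi> d - \<phi> c\<bar>"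
      unfolding V_def[of c] using zero by (intro cSup_least) (auto simp: le_diff_eq)
    then show ?thesis by simp
  qed
  have cont: "continuous_on {a..b} \<phi>" by (rule absolutely_continuous_arc_imp_continuous_on[OF ac])
  \<comment> \<open>The points reached with an admissible loss: slope \<open>e\<close> for the good
    points, \<open>V\<close> for the cover. The supremum of \<open>P\<close> is shown to be a member
    and to equal \<open>b\<close>.\<close>
  define P where "P = {c \<in> {a..b}. \<phi> c \<ge> \<phi> a - e * (c - a) - V c}"
  have Pa: "a \<in> P" using V_nonneg[of a] \<open>a \<le> b\<close> by (auto simp: P_def)
  have bddP: "bdd_above P" by (rule bdd_aboveI[of _ b]) (auto simp: P_def)
  define c where "c = Sup P"
  have "a \<le> c" unfolding c_def by (rule cSup_upper[OF Pa bddP])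
  have "c \<le> b" unfolding c_def by (rule cSup_least) (use Pa in \<open>auto simp: P_def\<close>)
  note c = \<open>a \<le> c\<close> \<open>c \<le> b\<close>
  \<comment> \<open>Continuity of \<open>\<phi>\<close> and monotonicity of \<open>V\<close> suffice
    for passing to the supremum; \<open>V\<close> need not be known to be continuous.\<close>
  have cP: "c \<in> P"
  proof -
    have "\<phi> a - e * (c - a) - V c - \<phi> c \<le> 0"
    proof (rule field_le_epsilon)
      fix \<eta> :: real assume \<eta>: "\<eta> > 0"
      obtain d where d: "d > 0" "\<And>s. s \<in> {a..b} \<Longrightarrow> dist s c < d \<Longrightarrow> dist (\<phi> s) (\<phi> c) < \<eta>"
        using cont c \<eta> unfolding continuous_on_iff by (meson atLeastAtMost_iff)
      obtain s where s: "s \<in> P" "c - d < s"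
        using less_cSupD[of P "c - d"] Pa d(1) unfolding c_def by (metis diff_less_eq empty_iff less_add_same_cancel1)
      have "s \<le> c" unfolding c_def by (rule cSup_upper[OF s(1) bddP])
      have "dist (\<phi> s) (\<phi> c) < \<eta>" using d(2)[of s] s \<open>s \<le> c\<close> by (auto simp: P_def dist_real_def)
      moreover have "V s \<le> V c" using V_mono[OF \<open>s \<le> c\<close>] c by auto
      moreover have "e * (s - a) \<le> e * (c - a)" using e \<open>s \<le> c\<close> by simp
      moreover have "\<phi> s \<ge> \<phi> a - e * (s - a) - V s" using s by (simp add: P_def)
      ultimately show "\<phi> a - e * (c - a) - V c - \<phi> c \<le> 0 + \<eta>" by (auto simp: dist_real_def)
    qed
    then show ?thesis using c by (auto simp: P_def)
  qed
  have "c = b"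
  proof (rule ccontr)
    assume "c \<noteq> b"
    then have cb: "c < b" using c by auto
    \<comment> \<open>A member of \<open>P\<close> below \<open>b\<close> can always be passed:
      inside the open set \<open>U\<close> by \<open>V_add\<close>, outside it by the Dini
      condition.\<close>
    have "\<exists>t\<in>P. t > c"
    proof (cases "c \<in> U")
      case True
      then obtain r where r: "r > 0" "cball c r \<subseteq> U" using U(1) open_contains_cball by blast
      define t where "t = min (c + r) b"
      have t: "c < t" "t \<le> b" "{c..t} \<subseteq> U"
      proof -
        show "{c..t} \<subseteq> U" using r by (auto simp: t_def dist_real_def subset_iff)
      qed (use r cb in \<open>auto simp: t_def\<close>)
      have "V c + \<bar>\<phi> t - \<phi> c\<bar> \<le> V t" using V_add[of c t] t c by auto
      moreover have "e * (c - a) \<le> e * (t - a)" using e t by simp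
      ultimately have "t \<in> P" using cP t c by (auto simp: P_def)
      then show ?thesis using t by auto
    next
      case False
      then have "c \<notin> N" "c \<noteq> a" using U by auto
      then have "c \<in> {a<..<b} - N" using c cb by auto
      then obtain d where d: "d > 0" "\<forall>t\<in>{c<..<c + d}. t \<le> b \<longrightarrow> \<phi> t \<ge> \<phi> c - e * (t - c)"
        using Dini e by blast
      define t where "t = min (c + d / 2) b"
      have t: "c < t" "t \<le> b" "t < c + d" using d cb by (auto simp: t_def)
      have "\<phi> t \<ge> \<phi> c - e * (t - c)" using d t by auto
      moreover have "e * (t - c) + e * (c - a) = e * (t - a)" by (simp add: algebra_simps)
      moreover have "V c \<le> V t" using V_mono t by auto
      ultimately have "t \<in> P" using cP t c by (auto simp: P_def)
      then show ?thesis using t by auto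
    qed
    then obtain t where "t \<in> P" "t > c" by blast
    then show False using cSup_upper[OF _ bddP, of t] by (auto simp: c_def)
  qed
  then have "\<phi> b \<ge> \<phi> a - e * (b - a) - V b" using cP by (simp add: P_def)
  then have "\<phi> a \<le> \<phi> b + (e * (b - a) + e)" using V_le[of b] by auto
  also have "e * (b - a) + e = e'" 
  proof -
    have "e * (b - a) + e = e * (b - a + 1)" by (simp add: algebra_simps)
    then show ?thesis using \<open>a \<le> b\<close> by (simp add: e_def)
  qed
  finally show "\<phi> a \<le> \<phi> b + e'" .
qed

text \<open>Reversal of time turns the left Dini condition into the right one; the negated
  exceptional set stays negligible.\<close>

lemma absolutely_continuous_arc_decreasing_Dini:
  fixes \<phi> :: "real \<Rightarrow> real"
  assumes ac: "absolutely_continuous_arc a b \<phi>" and "a \<le> b" and N: "negligible N"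
    and Dini: "\<And>s e. s \<in> {a<..<b} - N \<Longrightarrow> e > 0 \<Longrightarrow>
      \<exists>d>0. \<forall>t\<in>{s - d<..<s}. a \<le> t \<longrightarrow> \<phi> t \<ge> \<phi> s - e * (s - t)"
  shows "\<phi> b \<le> \<phi> a"
proof -
  have "negligible (uminus ` N)"
    using N by (intro negligible_differentiable_image_negligible) (auto intro: derivative_intros)
  moreover have "\<exists>d>0. \<forall>t\<in>{s<..<s + d}. t \<le> - a \<longrightarrow> \<phi> (- t) \<ge> \<phi> (- s) - e * (t - s)"
    if s: "s \<in> {- b<..<- a} - uminus ` N" and "e > 0" for s e
  proof -
    have "- s \<notin> N" using s by (metis DiffD2 add.inverse_inverse imageI)
    then have "- s \<in> {a<..<b} - N" using s by auto
    then obtain d where d: "d > 0" "\<And>t. t \<in> {- s - d<..<- s} \<Longrightarrow> a \<le> t \<Longrightarrow> \<phi> t \<ge> \<phi> (- s) - e * (- s - t)"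
      using Dini[of "- s" e] \<open>e > 0\<close> by blast
    have "\<phi> (- t) \<ge> \<phi> (- s) - e * (t - s)" if "t \<in> {s<..<s + d}" "t \<le> - a" for t
      using d(2)[of "- t"] that by auto
    then show ?thesis using d(1) by blast
  qed
  ultimately show ?thesis
    using absolutely_continuous_arc_increasing_Dini[OF absolutely_continuous_arc_reflect[OF ac], of "uminus ` N"]
      \<open>a \<le> b\<close> by simp
qed

text \<open>Where the derivative is nonnegative, difference quotients eventually exceed
  \<open>- e\<close>, which is the Dini condition.\<close>

lemma absolutely_continuous_arc_increasing:
  fixes \<phi> :: "real \<Rightarrow> real"
  assumes ac: "absolutely_continuous_arc a b \<phi>" and N: "negligible N"
    and der: "\<And>s. s \<in> {a<..<b} - N \<Longrightarrow> \<exists>D\<ge>0. (\<phi> has_real_derivative D) (at s)"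
    and st: "a \<le> s" "s \<le> t" "t \<le> b"
  shows "\<phi> s \<le> \<phi> t"
proof (rule absolutely_continuous_arc_increasing_Dini[OF _ \<open>s \<le> t\<close> N])
  show "absolutely_continuous_arc s t \<phi>"
    using ac st by (rule_tac absolutely_continuous_arc_subinterval) auto
  fix u e :: real assume u: "u \<in> {s<..<t} - N" and e: "e > 0"
  then have "u \<in> {a<..<b} - N" using st by auto
  then obtain D where D: "D \<ge> 0" "(\<phi> has_real_derivative D) (at u)" using der by blast
  then have "((\<lambda>h. (\<phi> (u + h) - \<phi> u) / h) \<longlongrightarrow> D) (at 0)" by (simp add: DERIV_def)
  then obtain d where d: "d > 0" "\<And>h. h \<noteq> 0 \<Longrightarrow> \<bar>h\<bar> < d \<Longrightarrow> \<bar>(\<phi> (u + h) - \<phi> u) / h - D\<bar> < e"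
    using e unfolding LIM_eq by (metis diff_zero real_norm_def)
  have "\<phi> v \<ge> \<phi> u - e * (v - u)" if "v \<in> {u<..<u + d}" for v
  proof -
    have "(\<phi> v - \<phi> u) / (v - u) > - e" using d(2)[of "v - u"] that D(1) by (auto simp: abs_less_iff)
    then show ?thesis using that by (auto simp: field_simps)
  qed
  then show "\<exists>d>0. \<forall>v\<in>{u<..<u + d}. v \<le> t \<longrightarrow> \<phi> u - e * (v - u) \<le> \<phi> v" using d(1) by blast
qed

section \<open>Existence for Lipschitz differential equations\<close>

text \<open>The increment is split by first moving the state at the new parameter, where the uniform
  Lipschitz bound applies, and then moving the parameter at the fixed state.\<close>

lemma continuous_on_Times_uniformly_lipschitz:
  fixes G :: "'s::metric_space \<Rightarrow> 'a::real_normed_vector \<Rightarrow> 'b::real_normed_vector"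
  assumes cont: "\<And>y. continuous_on S (\<lambda>s. G s y)"
    and lip: "\<And>s. s \<in> S \<Longrightarrow> K-lipschitz_on UNIV (G s)"
  shows "continuous_on (S \<times> UNIV) (\<lambda>(s, y). G s y)"
  unfolding continuous_on_def
proof
  fix sy :: "'s \<times> 'a" assume "sy \<in> S \<times> UNIV"
  then obtain s y where sy: "sy = (s, y)" and s: "s \<in> S" by auto
  let ?F = "at (s, y) within S \<times> UNIV"
  have fst: "(fst \<longlongrightarrow> s) ?F" and snd: "(snd \<longlongrightarrow> y) ?F"
    by (auto intro!: tendsto_eq_intros)
  have "continuous_on (S \<times> UNIV) (\<lambda>z. G (fst z) y)"
    by (rule continuous_on_compose2[OF cont[of y]]) (auto intro: continuous_intros)
  then have "((\<lambda>z. G (fst z) y) \<longlongrightarrow> G s y) ?F"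
    using s by (auto simp: continuous_on_def)
  then have lim: "((\<lambda>z. K * norm (snd z - y) + norm (G (fst z) y - G s y)) \<longlongrightarrow> 0) ?F"
    by (auto intro!: tendsto_eq_intros snd)
  have "norm (G (fst z) (snd z) - G s y) \<le> K * norm (snd z - y) + norm (G (fst z) y - G s y)"
    if "z \<in> S \<times> UNIV" for z
  proof -
    have "norm (G (fst z) (snd z) - G s y) \<le> norm (G (fst z) (snd z) - G (fst z) y) + norm (G (fst z) y - G s y)"
      using norm_triangle_ineq[of "G (fst z) (snd z) - G (fst z) y" "G (fst z) y - G s y"] by simp
    also have "norm (G (fst z) (snd z) - G (fst z) y) \<le> K * norm (snd z - y)"
      using lipschitz_onD[OF lip, of "fst z" "snd z" y] that by (auto simp: dist_norm)
    finally show ?thesis by simp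
  qed
  then have "\<forall>\<^sub>F z in ?F. norm (G (fst z) (snd z) - G s y) \<le> K * norm (snd z - y) + norm (G (fst z) y - G s y)"
    by (auto simp: eventually_at_filter intro: eventuallyI)
  from Lim_null_comparison[OF this lim]
  have "((\<lambda>z. G (fst z) (snd z)) \<longlongrightarrow> G s y) ?F" by (rule LIM_zero_cancel)
  then show "((\<lambda>(s, y). G s y) \<longlongrightarrow> (case sy of (s, y) \<Rightarrow> G s y)) (at sy within S \<times> UNIV)"
    by (simp add: sy case_prod_unfold)
qed

text \<open>The Picard operator is a contraction for the sup norm weighted by \<open>exp (L * s)\<close>; in terms of
  \<open>w s = exp (L * s) * y s\<close> this is the plain sup norm of bounded continuous functions.\<close>

lemma ode_terminal_value_exists:
  fixes G :: "real \<Rightarrow> 'a::euclidean_space \<Rightarrow> 'a"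
  assumes "a \<le> b"
    and cont: "\<And>y. continuous_on {a..b} (\<lambda>s. G s y)"
    and lip: "\<And>s. s \<in> {a..b} \<Longrightarrow> K-lipschitz_on UNIV (G s)"
  shows "\<exists>y. y b = z \<and> (\<forall>s\<in>{a..b}. (y has_vector_derivative G s (y s)) (at s within {a..b}))"
proof -
  \<comment> \<open>This weight makes the contraction factor \<open>K / L\<close> at most one half
    and stays positive when \<open>K\<close> is zero.\<close>
  define L where "L = 2 * K + 1"
  have K: "K \<ge> 0" using lip[of a] \<open>a \<le> b\<close> by (auto intro: lipschitz_on_nonneg)
  have L: "L > 0" "K / L \<le> 1 / 2" using K by (auto simp: L_def field_simps)
  \<comment> \<open>Clamping to the interval extends functions constantly to the whole line, where
    the type of bounded continuous functions lives.\<close>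
  define c where "c s = max a (min b s)" for s
  have c: "c s \<in> {a..b}" for s using \<open>a \<le> b\<close> by (auto simp: c_def)
  have c_id: "c s = s" if "s \<in> {a..b}" for s using that by (auto simp: c_def)
  \<comment> \<open>\<open>Y\<close> removes the exponential weight, \<open>I\<close> integrates
    backwards from the terminal value, and \<open>J\<close> restores the weight.\<close>
  define Y :: "(real \<Rightarrow>\<^sub>C 'a) \<Rightarrow> real \<Rightarrow> 'a" where "Y w \<tau> = exp (- (L * \<tau>)) *\<^sub>R apply_bcontfun w \<tau>" for w \<tau>
  define g where "g w \<tau> = G \<tau> (Y w \<tau>)" for w \<tau>
  define I where "I w s = z - integral {s..b} (g w)" for w s
  define J where "J w s = exp (L * c s) *\<^sub>R I w (c s)" for w s
  have cont_g: "continuous_on {a..b} (g w)" for w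
  proof -
    have "continuous_on {a..b} (\<lambda>\<tau>. (\<tau>, Y w \<tau>))" unfolding Y_def
      by (intro continuous_intros continuous_on_apply_bcontfun)
    from continuous_on_compose2[OF continuous_on_Times_uniformly_lipschitz[OF cont lip] this] show ?thesis by (auto simp: g_def[abs_def])
  qed
  have der_I: "(I w has_vector_derivative g w s) (at s within {a..b})" if "s \<in> {a..b}" for w s
    unfolding I_def[abs_def]
    using has_vector_derivative_diff[OF has_vector_derivative_const integral_has_vector_derivative'[OF cont_g that]]
    by simp
  have cont_I: "continuous_on {a..b} (I w)" for w
    using der_I has_vector_derivative_continuous by (metis continuous_on_eq_continuous_within)
  have J: "J w \<in> bcontfun" for w
  proof -
    have co: "continuous_on {a..b} (\<lambda>r. exp (L * r) *\<^sub>R I w r)"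
      by (intro continuous_intros cont_I)
    have "continuous_on UNIV c" unfolding c_def[abs_def] by (intro continuous_intros)
    moreover have "range c \<subseteq> {a..b}" using c by auto
    ultimately have "continuous_on UNIV (J w)"
      unfolding J_def[abs_def] by (rule continuous_on_compose2[OF co])
    moreover have "bounded (range (J w))"
    proof (rule bounded_subset)
      show "bounded ((\<lambda>r. exp (L * r) *\<^sub>R I w r) ` {a..b})"
        by (intro compact_imp_bounded compact_continuous_image co compact_Icc)
      show "range (J w) \<subseteq> (\<lambda>r. exp (L * r) *\<^sub>R I w r) ` {a..b}"
        using c by (auto simp: J_def)
    qed
    ultimately show ?thesis by (simp add: bcontfun_def)
  qed
  define \<Phi> where "\<Phi> w = Bcontfun (J w)" for w
  have \<Phi>: "apply_bcontfun (\<Phi> w) s = J w s" for w s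
    by (simp add: \<Phi>_def Bcontfun_inverse J)
  have "dist (\<Phi> w) (\<Phi> v) \<le> 1 / 2 * dist w v" for w v
  proof (rule dist_bound)
    fix s
    define r where "r = c s"
    have r: "r \<in> {a..b}" "r \<le> b" using c by (auto simp: r_def)
    define D where "D = dist w v"
    have int: "g u integrable_on {r..b}" for u
      using r by (intro integrable_continuous_real continuous_on_subset[OF cont_g]) auto
    \<comment> \<open>The difference of the integrands is at most
      \<open>K * exp (- (L * \<tau>)) * D\<close>. Its integral is at most
      \<open>(K * D / L) * exp (- (L * r))\<close>, and the outer weight \<open>exp (L * r)\<close>
      cancels the exponential.\<close>
    have "((\<lambda>\<tau>. K * exp (- (L * \<tau>)) * D) has_integral
        (- (K * D / L) * exp (- (L * b)) - (- (K * D / L) * exp (- (L * r))))) {r..b}"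
      using r(2) L(1)
      by (intro fundamental_theorem_of_calculus)
         (auto intro!: derivative_eq_intros simp flip: has_real_derivative_iff_has_vector_derivative)
    then have e: "((\<lambda>\<tau>. K * exp (- (L * \<tau>)) * D) has_integral (K * D / L) * (exp (- (L * r)) - exp (- (L * b)))) {r..b}"
      by (simp add: algebra_simps)
    have "dist (\<Phi> w s) (\<Phi> v s) = exp (L * r) * norm (I w r - I v r)"
      by (simp add: \<Phi> J_def r_def dist_norm flip: scaleR_diff_right)
    also have "I w r - I v r = integral {r..b} (\<lambda>\<tau>. g v \<tau> - g w \<tau>)"
      by (simp add: I_def integral_diff int)
    also have "norm \<dots> \<le> integral {r..b} (\<lambda>\<tau>. K * exp (- (L * \<tau>)) * D)"
    proof (rule integral_norm_bound_integral)
      fix \<tau> assume \<tau>: "\<tau> \<in> {r..b}"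
      have "norm (g v \<tau> - g w \<tau>) \<le> K * norm (Y v \<tau> - Y w \<tau>)"
        using lipschitz_onD[OF lip[of \<tau>], of "Y v \<tau>" "Y w \<tau>"] \<tau> r by (simp add: g_def dist_norm)
      also have "norm (Y v \<tau> - Y w \<tau>) = exp (- (L * \<tau>)) * dist (w \<tau>) (v \<tau>)"
        by (simp add: Y_def dist_norm norm_minus_commute flip: scaleR_diff_right)
      also have "K * (exp (- (L * \<tau>)) * dist (w \<tau>) (v \<tau>)) \<le> K * (exp (- (L * \<tau>)) * D)"
        using K by (intro mult_left_mono) (auto simp: D_def dist_bounded)
      finally show "norm (g v \<tau> - g w \<tau>) \<le> K * exp (- (L * \<tau>)) * D" by (simp add: mult.assoc)
    qed (use int e in \<open>auto intro: integrable_diff has_integral_integrable\<close>)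
    also have "integral {r..b} (\<lambda>\<tau>. K * exp (- (L * \<tau>)) * D) = (K * D / L) * (exp (- (L * r)) - exp (- (L * b)))"
      using e by (rule integral_unique)
    also have "\<dots> \<le> (K * D / L) * exp (- (L * r))"
      using K L by (intro mult_left_mono) (auto simp: D_def)
    finally have "dist (\<Phi> w s) (\<Phi> v s) \<le> exp (L * r) * ((K * D / L) * exp (- (L * r)))"
      by simp
    also have "\<dots> = (K / L) * D" by (simp add: exp_minus field_simps)
    also have "\<dots> \<le> 1 / 2 * D" using L(2) by (intro mult_right_mono) (auto simp: D_def)
    finally show "dist (\<Phi> w s) (\<Phi> v s) \<le> 1 / 2 * dist w v" by (simp add: D_def)
  qed
  then obtain w where w: "\<Phi> w = w"
    using banach_fix_type[of "1/2" \<Phi>] by auto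
  \<comment> \<open>For the fixed point, the integrand of \<open>I w\<close> is evaluated along
    \<open>I w\<close> itself, so \<open>I w\<close> solves the equation.\<close>
  have Yw: "Y w s = I w s" if "s \<in> {a..b}" for s
  proof -
    have "w s = exp (L * s) *\<^sub>R I w s" using \<Phi>[of w s] c_id[OF that] by (simp add: w J_def)
    then show ?thesis by (simp add: Y_def exp_minus)
  qed
  have "I w b = z" by (simp add: I_def)
  moreover have "(I w has_vector_derivative G s (I w s)) (at s within {a..b})" if "s \<in> {a..b}" for s
    using der_I[OF that, of w] Yw[OF that] by (simp add: g_def)
  ultimately show ?thesis by blast
qed

section \<open>Hamiltonians and semiconvexity\<close>

lemma max_hamiltonian_upper:
  assumes "compact (F x)" "v \<in> F x"
  shows "v \<bullet> p \<le> max_hamiltonian F x p"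
proof -
  have "F x \<noteq> {}" using assms by auto
  then show ?thesis using hamiltonians_attained(1)[of F x p] assms by auto
qed

text \<open>Positive homogeneity transports (H1) from the unit sphere to all covectors.\<close>

lemma max_hamiltonian_scaleR:
  assumes "F x \<noteq> {}" "compact (F x)" "0 \<le> a"
  shows "max_hamiltonian F x (a *\<^sub>R p) = a * max_hamiltonian F x p"
proof -
  obtain v where v: "v \<in> F x" "max_hamiltonian F x p = v \<bullet> p"
    using hamiltonians_attained(1)[of F x p] assms by blast
  obtain w where w: "w \<in> F x" "max_hamiltonian F x (a *\<^sub>R p) = w \<bullet> (a *\<^sub>R p)"
    using hamiltonians_attained(1)[of F x "a *\<^sub>R p"] assms by blast
  have "w \<bullet> (a *\<^sub>R p) \<le> a * max_hamiltonian F x p"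
    using max_hamiltonian_upper[of F x w p] assms w by (simp add: mult_left_mono)
  moreover have "v \<bullet> (a *\<^sub>R p) \<le> max_hamiltonian F x (a *\<^sub>R p)"
    using max_hamiltonian_upper[of F x v "a *\<^sub>R p"] assms v by simp
  ultimately show ?thesis using v w by (intro antisym) simp_all
qed

text \<open>A maximizer for \<open>p\<close> is a competitor for \<open>q\<close>.\<close>

lemma max_hamiltonian_lipschitz_right:
  assumes "F x \<noteq> {}" "compact (F x)" and M: "\<And>v. v \<in> F x \<Longrightarrow> norm v \<le> M"
  shows "max_hamiltonian F x p - max_hamiltonian F x q \<le> M * norm (p - q)"
proof -
  obtain v where v: "v \<in> F x" "max_hamiltonian F x p = v \<bullet> p"
    using hamiltonians_attained(1)[of F x p] assms by blast
  have "v \<bullet> q \<le> max_hamiltonian F x q" by (intro max_hamiltonian_upper assms v)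
  then have "max_hamiltonian F x p - max_hamiltonian F x q \<le> v \<bullet> (p - q)"
    using v by (simp add: inner_diff_right)
  also have "\<dots> \<le> norm v * norm (p - q)" by (rule norm_cauchy_schwarz)
  also have "\<dots> \<le> M * norm (p - q)" using M v by (intro mult_right_mono) auto
  finally show ?thesis .
qed

text \<open>By the inclusion, a maximizer at \<open>x\<close> lies within
  \<open>L * norm (y - x)\<close> of a competitor at \<open>y\<close>.\<close>

lemma max_hamiltonian_lipschitz_left:
  assumes "F x \<noteq> {}" "compact (F x)" "compact (F y)"
    and sub: "F x \<subseteq> {w + (L * norm (y - x)) *\<^sub>R b | w b. w \<in> F y \<and> b \<in> cball 0 1}" and "L \<ge> 0"
  shows "max_hamiltonian F x p - max_hamiltonian F y p \<le> L * norm p * norm (y - x)"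
proof -
  obtain v where v: "v \<in> F x" "max_hamiltonian F x p = v \<bullet> p"
    using hamiltonians_attained(1)[of F x p] assms by blast
  obtain w b where w: "w \<in> F y" "norm b \<le> 1" "v = w + (L * norm (y - x)) *\<^sub>R b"
    using sub v(1) by auto
  have "w \<bullet> p \<le> max_hamiltonian F y p" by (intro max_hamiltonian_upper assms w)
  moreover have "v \<bullet> p = w \<bullet> p + (L * norm (y - x)) * (b \<bullet> p)"
    using w(3) by (simp add: inner_add_left)
  moreover have "b \<bullet> p \<le> norm p"
    using norm_cauchy_schwarz[of b p] mult_right_mono[OF w(2), of "norm p"] by simp
  then have "(L * norm (y - x)) * (b \<bullet> p) \<le> (L * norm (y - x)) * norm p"
    using \<open>L \<ge> 0\<close> by (intro mult_left_mono) auto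
  ultimately show ?thesis using v by (simp add: algebra_simps)
qed

text \<open>Translates conservation of the maximized Hamiltonian into the claim about the minimized
  one.\<close>

lemma min_hamiltonian_uminus:
  assumes "F x \<noteq> {}" "compact (F x)"
  shows "min_hamiltonian F x (- p) = - max_hamiltonian F x p"
proof -
  obtain v where "v \<in> F x" "max_hamiltonian F x p = v \<bullet> p" "\<forall>w\<in>F x. w \<bullet> p \<le> v \<bullet> p"
    using hamiltonians_attained(1)[of F x p] assms by blast
  moreover obtain w where "w \<in> F x" "min_hamiltonian F x (- p) = w \<bullet> (- p)" "\<forall>v\<in>F x. w \<bullet> (- p) \<le> v \<bullet> (- p)"
    using hamiltonians_attained(2)[of F x "- p"] assms by blast
  ultimately show ?thesis by force
qed

text \<open>Envelope argument: the Hamiltonian minus the linear function given by \<open>v\<close>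
  is nonnegative and vanishes at \<open>p\<close>, so its derivative there is zero. In particular
  the maximizer is unique.\<close>

lemma maximizer_eq_gradient:
  assumes "compact (F x)" and diff: "max_hamiltonian F x differentiable (at p)"
    and v: "v \<in> F x" "v \<bullet> p = max_hamiltonian F x p"
  shows "v = gradient (max_hamiltonian F x) p"
proof -
  define D where "D = gradient (max_hamiltonian F x) p"
  have D: "GDERIV (max_hamiltonian F x) p :> D"
    using diff by (simp add: GDERIV_iff_gradient D_def)
  then have "((\<lambda>q. max_hamiltonian F x q - v \<bullet> q) has_derivative (\<lambda>h. h \<bullet> D - v \<bullet> h)) (at p)"
    unfolding gderiv_def by (intro derivative_intros)
  then have "(\<lambda>h. h \<bullet> D - v \<bullet> h) = (\<lambda>h. 0)"
    by (rule differential_zero_maxmin[OF UNIV_I open_UNIV]) (use max_hamiltonian_upper[of F x v] assms in auto)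
  then have "\<forall>h. h \<bullet> D = h \<bullet> v" by (metis inner_commute right_minus_eq)
  then show ?thesis by (simp add: vector_eq_ldot D_def)
qed

lemma gradient_max_hamiltonian:
  assumes "F x \<noteq> {}" "compact (F x)" and diff: "max_hamiltonian F x differentiable (at p)"
  shows "gradient (max_hamiltonian F x) p \<in> F x"
    and "gradient (max_hamiltonian F x) p \<bullet> p = max_hamiltonian F x p"
proof -
  obtain v where "v \<in> F x" "max_hamiltonian F x p = v \<bullet> p"
    using hamiltonians_attained(1)[of F x p] assms by blast
  then show "gradient (max_hamiltonian F x) p \<in> F x"
    and "gradient (max_hamiltonian F x) p \<bullet> p = max_hamiltonian F x p"
    using maximizer_eq_gradient[of F x p v] assms by auto
qed

text \<open>Uniqueness of maximizers makes the graph of the gradient the zero set of a continuous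
  function. A closed graph over a compact range gives continuity.\<close>

lemma continuous_on_gradient_max_hamiltonian:
  fixes F :: "'a::euclidean_space \<Rightarrow> 'a set"
  assumes F: "F x \<noteq> {}" "compact (F x)"
    and diff: "\<And>p. p \<noteq> 0 \<Longrightarrow> max_hamiltonian F x differentiable (at p)"
  shows "continuous_on (- {0}) (gradient (max_hamiltonian F x))"
proof -
  let ?g = "gradient (max_hamiltonian F x)"
  have maps: "?g \<in> - {0} \<rightarrow> F x" using gradient_max_hamiltonian(1)[OF F diff] by auto
  have "continuous_on (- {0}) (max_hamiltonian F x)"
    by (intro continuous_at_imp_continuous_on ballI differentiable_imp_continuous_within diff) auto
  then have cont: "continuous_on ((- {0}) \<times> F x) (\<lambda>z. max_hamiltonian F x (fst z) - snd z \<bullet> fst z)"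
    by (intro continuous_intros continuous_on_compose2[of "- {0}" "max_hamiltonian F x" _ fst]) auto
  have "(\<lambda>p. (p, ?g p)) ` (- {0}) = ((- {0}) \<times> F x) \<inter> (\<lambda>z. max_hamiltonian F x (fst z) - snd z \<bullet> fst z) -` {0}"
  proof (intro set_eqI iffI)
    fix z assume "z \<in> (\<lambda>p. (p, ?g p)) ` (- {0})"
    then show "z \<in> ((- {0}) \<times> F x) \<inter> (\<lambda>z. max_hamiltonian F x (fst z) - snd z \<bullet> fst z) -` {0}"
      using gradient_max_hamiltonian[OF F diff] by auto
  next
    fix z assume "z \<in> ((- {0}) \<times> F x) \<inter> (\<lambda>z. max_hamiltonian F x (fst z) - snd z \<bullet> fst z) -` {0}"
    then show "z \<in> (\<lambda>p. (p, ?g p)) ` (- {0})"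
      using maximizer_eq_gradient[of F x "fst z" "snd z"] diff F by (intro image_eqI[of _ _ "fst z"]) (auto simp: prod_eq_iff)
  qed
  moreover have "closedin (top_of_set ((- {0}) \<times> F x))
      (((- {0}) \<times> F x) \<inter> (\<lambda>z. max_hamiltonian F x (fst z) - snd z \<bullet> fst z) -` {0})"
    by (intro continuous_closedin_preimage cont closed_singleton)
  ultimately show ?thesis using continuous_closed_graph_eq[OF F(2) maps] by simp
qed

text \<open>Halving the increment \<open>n\<close> times loses at most \<open>c / 2 * (norm (z - y))\<^sup>2\<close> in total.\<close>

lemma semiconvex_on_gradient_le:
  fixes g :: "'a::euclidean_space \<Rightarrow> real"
  assumes g: "semiconvex_on c \<Omega> g" and \<Omega>: "convex \<Omega>" "y \<in> \<Omega>" "z \<in> \<Omega>"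
    and D: "GDERIV g y :> D" and "c \<ge> 0"
  shows "g y + (z - y) \<bullet> D \<le> g z + c / 2 * (norm (z - y))\<^sup>2"
proof -
  define \<phi> where "\<phi> t = g (y + t *\<^sub>R (z - y)) - g y" for t
  define d where "d = (norm (z - y))\<^sup>2"
  \<comment> \<open>The semiconvexity inequality centred at the midpoint of \<open>y\<close> and
    \<open>y + t *\<^sub>R (z - y)\<close>.\<close>
  have half: "2 * \<phi> (t / 2) \<le> \<phi> t + c * (t / 2)\<^sup>2 * d" if t: "0 \<le> t" "t \<le> 1" for t
  proof -
    let ?m = "y + (t / 2) *\<^sub>R (z - y)" and ?k = "(t / 2) *\<^sub>R (z - y)"
    have [simp]: "?m - ?k = y" by simp
    have e: "?m + ?k = y + t *\<^sub>R (z - y)" by (simp add: scaleR_left_distrib[symmetric] add.assoc)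
    have "y + t *\<^sub>R (z - y) = (1 - t) *\<^sub>R y + t *\<^sub>R z" by (simp add: algebra_simps)
    then have "y + t *\<^sub>R (z - y) \<in> \<Omega>" using convexD_alt[OF \<Omega>(1), of y z t] \<Omega> t by simp
    then have "closed_segment (?m - ?k) (?m + ?k) \<subseteq> \<Omega>"
      using \<Omega> by (simp add: e closed_segment_subset)
    then have "g (?m + ?k) + g (?m - ?k) - 2 * g ?m \<ge> - c * (norm ?k)\<^sup>2"
      using g unfolding semiconvex_on_def by blast
    moreover have "(norm ?k)\<^sup>2 = (t / 2)\<^sup>2 * d" by (simp add: d_def power_mult_distrib power_divide)
    ultimately show ?thesis by (simp add: \<phi>_def e)
  qed
  \<comment> \<open>Step \<open>n\<close> loses \<open>c * d / 4 * (1 / 2 ^ n)\<close>; the bracket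
    is the partial sum of this geometric series.\<close>
  have iter: "2 ^ n * \<phi> (1 / 2 ^ n) \<le> \<phi> 1 + c * d / 2 * (1 - 1 / 2 ^ n)" for n :: nat
  proof (induction n)
    case (Suc n)
    have "2 * \<phi> (1 / 2 ^ Suc n) \<le> \<phi> (1 / 2 ^ n) + c * (1 / 2 ^ Suc n)\<^sup>2 * d"
      using half[of "1 / 2 ^ n"] by (simp add: field_simps)
    then have "2 ^ n * (2 * \<phi> (1 / 2 ^ Suc n)) \<le> 2 ^ n * (\<phi> (1 / 2 ^ n) + c * (1 / 2 ^ Suc n)\<^sup>2 * d)"
      by (intro mult_left_mono) auto
    also have "\<dots> = 2 ^ n * \<phi> (1 / 2 ^ n) + c * d / 4 * (1 / 2 ^ n)"
      by (simp add: field_simps power2_eq_square)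
    finally show ?case using Suc.IH by (simp add: field_simps)
  qed simp
  have der: "(\<phi> has_real_derivative (z - y) \<bullet> D) (at 0)"
  proof -
    have "(g has_derivative (\<lambda>h. h \<bullet> D)) (at (y + 0 *\<^sub>R (z - y)))"
      using D by (simp add: gderiv_def)
    then have "((\<lambda>t. g (y + t *\<^sub>R (z - y)) - g y) has_derivative (\<lambda>t. (t *\<^sub>R (z - y)) \<bullet> D)) (at 0)"
      by (auto intro!: derivative_eq_intros has_derivative_compose[of "\<lambda>t. y + t *\<^sub>R (z - y)" _ _ _ g])
    moreover have "(\<lambda>t. (t *\<^sub>R (z - y)) \<bullet> D) = (*) ((z - y) \<bullet> D)" by (auto simp: mult.commute)
    ultimately show ?thesis by (simp add: has_field_derivative_def \<phi>_def[abs_def])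
  qed
  then have lim0: "((\<lambda>h. \<phi> h / h) \<longlongrightarrow> (z - y) \<bullet> D) (at 0)"
    by (simp add: DERIV_def \<phi>_def)
  \<comment> \<open>The scaled values \<open>2 ^ n * \<phi> (1 / 2 ^ n)\<close> are difference
    quotients, so they converge to the directional derivative.\<close>
  have "filterlim (\<lambda>n. 1 / 2 ^ n :: real) (at 0) sequentially"
    unfolding filterlim_at
    using LIMSEQ_divide_realpow_zero[of 2 1] by simp
  from filterlim_compose[OF lim0 this]
  have "(\<lambda>n. 2 ^ n * \<phi> (1 / 2 ^ n)) \<longlonglongrightarrow> (z - y) \<bullet> D" by (simp add: mult.commute)
  moreover have "2 ^ n * \<phi> (1 / 2 ^ n) \<le> \<phi> 1 + c * d / 2" for n
  proof -
    have "c * d / 2 * (1 - 1 / 2 ^ n) \<le> c * d / 2 * 1"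
      using \<open>c \<ge> 0\<close> by (intro mult_left_mono) (auto simp: d_def)
    then show ?thesis using iter[of n] by linarith
  qed
  ultimately have "(z - y) \<bullet> D \<le> \<phi> 1 + c * d / 2" by (intro LIMSEQ_le_const2) auto
  then show ?thesis by (simp add: \<phi>_def d_def)
qed

text \<open>The inequality for gradients survives limits of base points. For fixed \<open>z\<close>
  it describes a half-space of vectors, so it also survives the convex hull.\<close>

lemma semiconvex_on_clarke_gradient_le:
  fixes g :: "'a::euclidean_space \<Rightarrow> real"
  assumes g: "semiconvex_on c \<Omega> g" and \<Omega>: "convex \<Omega>" "open \<Omega>" "x \<in> \<Omega>" "z \<in> \<Omega>"
    and v: "v \<in> clarke_gradient g x" and "c \<ge> 0"
  shows "g x + (z - x) \<bullet> v \<le> g z + c / 2 * (norm (z - x))\<^sup>2"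
proof -
  let ?S = "{v. (z - x) \<bullet> v \<le> g z + c / 2 * (norm (z - x))\<^sup>2 - g x}"
  have "clarke_gradient g x \<subseteq> ?S"
    unfolding clarke_gradient_def
  proof (rule hull_minimal)
    show "convex ?S" by (rule convex_halfspace_le)
    show "{v. \<exists>y. y \<longlonglongrightarrow> x \<and> (\<forall>i. g differentiable at (y i)) \<and> (\<lambda>i. gradient g (y i)) \<longlonglongrightarrow> v} \<subseteq> ?S"
    proof clarify
      fix v y assume y: "y \<longlonglongrightarrow> x" "\<forall>i. g differentiable at (y i)" "(\<lambda>i. gradient g (y i)) \<longlonglongrightarrow> v"
      have "isCont g x"
        using g \<Omega> by (auto simp: semiconvex_on_def continuous_on_eq_continuous_at)
      then have gy: "(\<lambda>i. g (y i)) \<longlonglongrightarrow> g x" using y(1) by (rule isCont_tendsto_compose)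
      have "eventually (\<lambda>i. y i \<in> \<Omega>) sequentially"
        using y(1) \<Omega> by (simp add: topological_tendstoD)
      then have "eventually (\<lambda>i. g (y i) + (z - y i) \<bullet> gradient g (y i) \<le> g z + c / 2 * (norm (z - y i))\<^sup>2) sequentially"
        by eventually_elim
          (rule semiconvex_on_gradient_le[OF g \<Omega>(1) _ \<Omega>(4) _ \<open>c \<ge> 0\<close>], simp_all add: y GDERIV_iff_gradient)
      then have "g x + (z - x) \<bullet> v \<le> g z + c / 2 * (norm (z - x))\<^sup>2"
        by (rule tendsto_le[OF sequentially_bot, rotated 2]) (intro tendsto_intros y gy)+
      then show "(z - x) \<bullet> v \<le> g z + c / 2 * (norm (z - x))\<^sup>2 - g x" by simp
    qed
  qed
  then show ?thesis using v by auto
qed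

text \<open>The subgradient inequality is tested at a short step from \<open>x\<close> in the
  direction of \<open>v\<close>; the quadratic error disappears as the step shrinks.\<close>

lemma semiconvex_on_clarke_gradient_bound:
  fixes g :: "'a::euclidean_space \<Rightarrow> real"
  assumes g: "semiconvex_on c \<Omega> g" and \<Omega>: "convex \<Omega>" "open \<Omega>" "x \<in> \<Omega>"
    and v: "v \<in> clarke_gradient g x" and "c \<ge> 0" "B \<ge> 0"
    and B: "\<And>z. z \<in> \<Omega> \<Longrightarrow> g z - g x \<le> B * norm (z - x)"
  shows "norm v \<le> B"
proof (cases "v = 0")
  case True
  then show ?thesis using \<open>B \<ge> 0\<close> by simp
next
  case False
  obtain e where e: "e > 0" "cball x e \<subseteq> \<Omega>" using \<Omega> open_contains_cball by blast
  have *: "norm v \<le> B + c / 2 * t" if t: "0 < t" "t \<le> e" for t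
  proof -
    define z where "z = x + (t / norm v) *\<^sub>R v"
    have nz: "norm (z - x) = t" using t False by (simp add: z_def)
    then have "z \<in> \<Omega>" using e t by (intro subsetD[OF e(2)]) (auto simp: dist_norm norm_minus_commute)
    then have "(z - x) \<bullet> v \<le> B * t + c / 2 * t\<^sup>2"
      using semiconvex_on_clarke_gradient_le[OF g \<Omega> _ v \<open>c \<ge> 0\<close>, of z] B[of z] nz by simp
    also have "(z - x) \<bullet> v = t * norm v"
      using False by (simp add: z_def power2_norm_eq_inner[symmetric] power2_eq_square)
    also have "B * t + c / 2 * t\<^sup>2 = t * (B + c / 2 * t)" by (simp add: algebra_simps power2_eq_square)
    finally show ?thesis using t by simp
  qed
  show ?thesis
  proof (rule field_le_epsilon)
    fix \<eta> :: real assume "\<eta> > 0"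
    define t where "t = min e (\<eta> / (c + 1))"
    have t: "0 < t" "t \<le> e" "t \<le> \<eta> / (c + 1)"
      using e \<open>\<eta> > 0\<close> \<open>c \<ge> 0\<close> by (auto simp: t_def)
    have "c / 2 * t \<le> t * (c + 1)" using t \<open>c \<ge> 0\<close> by (simp add: field_simps)
    also have "\<dots> \<le> \<eta>" using t(3) \<open>c \<ge> 0\<close> by (simp add: pos_le_divide_eq)
    finally show "norm v \<le> B + \<eta>" using *[OF t(1,2)] t by simp
  qed
qed

lemma semiconvex_on_scale:
  assumes "semiconvex_on c \<Omega> g" "a \<ge> 0"
  shows "semiconvex_on (a * c) \<Omega> (\<lambda>x. a * g x)"
  unfolding semiconvex_on_def
proof (intro conjI allI impI)
  show "continuous_on \<Omega> (\<lambda>x. a * g x)"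
    using assms by (intro continuous_intros) (simp add: semiconvex_on_def)
  fix x k assume "closed_segment (x - k) (x + k) \<subseteq> \<Omega>"
  then have "- c * (norm k)\<^sup>2 \<le> g (x + k) + g (x - k) - 2 * g x"
    using assms by (simp add: semiconvex_on_def)
  from mult_left_mono[OF this \<open>a \<ge> 0\<close>]
  show "- (a * c) * (norm k)\<^sup>2 \<le> a * g (x + k) + a * g (x - k) - 2 * (a * g x)"
    by (simp add: algebra_simps)
qed

text \<open>Homogeneity reduces to a unit covector; for \<open>p = 0\<close> any unit covector
  serves.\<close>

lemma semiconvex_on_max_hamiltonian:
  fixes F :: "'a::euclidean_space \<Rightarrow> 'a set"
  assumes F: "\<And>x. F x \<noteq> {} \<and> compact (F x)"
    and sc: "\<And>p. p \<in> sphere 0 1 \<Longrightarrow> semiconvex_on c \<Omega> (\<lambda>x. max_hamiltonian F x p)"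
  shows "semiconvex_on (norm p * c) \<Omega> (\<lambda>x. max_hamiltonian F x p)"
proof -
  obtain u :: 'a where u: "u \<in> sphere 0 1" "p = norm p *\<^sub>R u"
  proof (cases "p = 0")
    case True
    obtain b :: 'a where "norm b = 1" using vector_choose_size[of 1] by auto
    then show ?thesis using True that by simp
  next
    case False
    then show ?thesis using that[of "p /\<^sub>R norm p"] by simp
  qed
  have "max_hamiltonian F x p = norm p * max_hamiltonian F x u" for x
    using max_hamiltonian_scaleR[of F x "norm p" u] F[of x] u(2) by simp
  then show ?thesis using semiconvex_on_scale[OF sc[OF u(1)], of "norm p"] by simp
qed

section \<open>Trajectories and the minimum time\<close>

lemma AE_lebesgue_on_imp_negligible:
  assumes "AE s in lebesgue_on {a..b::real}. P s"
  shows "\<exists>N. negligible N \<and> (\<forall>s\<in>{a..b} - N. P s)"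
proof -
  obtain N where N: "{s \<in> space (lebesgue_on {a..b}). \<not> P s} \<subseteq> N" 
    "emeasure (lebesgue_on {a..b}) N = 0" "N \<in> sets (lebesgue_on {a..b})"
    using assms by (rule AE_E)
  then have "N \<in> null_sets (lebesgue_on {a..b})" by auto
  then have "negligible N" by (simp add: null_sets_restrict_space negligible_iff_null_sets)
  then show ?thesis using N(1) by (intro exI[of _ N]) auto
qed

lemma AE_lebesgue_onI_negligible:
  assumes N: "negligible N" and P: "\<And>s. s \<in> {a..b::real} - N \<Longrightarrow> P s"
  shows "AE s in lebesgue_on {a..b}. P s"
proof (rule AE_I')
  have "N \<inter> {a..b} \<in> null_sets lebesgue"
    using negligible_subset[OF N] by (simp flip: negligible_iff_null_sets)
  then show "N \<inter> {a..b} \<in> null_sets (lebesgue_on {a..b})" by (simp add: null_sets_restrict_space)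
  show "{s \<in> space (lebesgue_on {a..b}). \<not> P s} \<subseteq> N \<inter> {a..b}" using P by auto
qed

text \<open>Adding the two endpoints to the null set makes all derivatives two-sided, the convenient
  form for shifting and joining.\<close>

lemma trajectory_iff_negligible:
  "trajectory F T x \<longleftrightarrow> absolutely_continuous_arc 0 T x \<and>
     (\<exists>N. negligible N \<and> (\<forall>s\<in>{0<..<T} - N. \<exists>v\<in>F (x s). (x has_vector_derivative v) (at s)))"
  (is "?L \<longleftrightarrow> ?R")
proof
  assume L: ?L
  then have "AE s in lebesgue_on {0..T}. \<exists>v\<in>F (x s). (x has_vector_derivative v) (at s within {0..T})"
    by (simp add: trajectory_def)
  from AE_lebesgue_on_imp_negligible[OF this] obtain N where N: "negligible N"
    "\<forall>s\<in>{0..T} - N. \<exists>v\<in>F (x s). (x has_vector_derivative v) (at s within {0..T})"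
    by (elim exE conjE)
  have "\<exists>v\<in>F (x s). (x has_vector_derivative v) (at s)" if "s \<in> {0<..<T} - N" for s
  proof -
    have "at s within {0..T} = at s" using that by (intro at_within_interior) auto
    moreover have "s \<in> {0..T} - N" using that by auto
    ultimately show ?thesis using N(2) by metis
  qed
  then show ?R using L N(1) by (auto simp: trajectory_def)
next
  assume R: ?R
  then obtain N where N: "negligible N" "\<And>s. s \<in> {0<..<T} - N \<Longrightarrow> \<exists>v\<in>F (x s). (x has_vector_derivative v) (at s)"
    by blast
  have "AE s in lebesgue_on {0..T}. \<exists>v\<in>F (x s). (x has_vector_derivative v) (at s within {0..T})"
  proof (rule AE_lebesgue_onI_negligible)
    show "negligible (N \<union> {0, T})" using N(1) by (simp add: negligible_Un)
    fix s assume "s \<in> {0..T} - (N \<union> {0, T})"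
    then have "s \<in> {0<..<T} - N" by auto
    then show "\<exists>v\<in>F (x s). (x has_vector_derivative v) (at s within {0..T})"
      using N(2) has_vector_derivative_at_within by blast
  qed
  then show ?L using R by (simp add: trajectory_def)
qed

section \<open>Restriction and concatenation of trajectories\<close>

lemma has_vector_derivative_shift:
  assumes "(f has_vector_derivative v) (at (s + t :: real))"
  shows "((\<lambda>s. f (s + t)) has_vector_derivative v) (at s)"
proof -
  have "((\<lambda>s. s + t) has_vector_derivative 1) (at s)"
    by (auto intro!: derivative_eq_intros)
  from vector_diff_chain_at[OF this assms] show ?thesis by (simp add: o_def)
qed

lemma trajectory_suffix:
  assumes x: "trajectory F T x" and t: "0 \<le> t" "t \<le> T"
  shows "trajectory F (T - t) (\<lambda>s. x (s + t))"
proof -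
  obtain N where ac: "absolutely_continuous_arc 0 T x" and N: "negligible N"
    "\<And>s. s \<in> {0<..<T} - N \<Longrightarrow> \<exists>v\<in>F (x s). (x has_vector_derivative v) (at s)"
    using x unfolding trajectory_iff_negligible by blast
  have "\<exists>v\<in>F (x (s + t)). ((\<lambda>s. x (s + t)) has_vector_derivative v) (at s)"
    if s: "s \<in> {0<..<T - t} - (+) (- t) ` N" for s
  proof -
    have "s + t \<notin> N" using s by (metis DiffD2 add.commute add_minus_cancel image_eqI add.inverse_inverse)
    then show ?thesis using N(2)[of "s + t"] s t has_vector_derivative_shift[of x _ s t] by auto
  qed
  moreover have "absolutely_continuous_arc 0 (T - t) (\<lambda>s. x (s + t))"
    using t by (intro absolutely_continuous_arc_shift[OF ac]) auto
  moreover have "negligible ((+) (- t) ` N)" using N(1) by (rule negligible_translation)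
  ultimately show ?thesis unfolding trajectory_iff_negligible by blast
qed

lemma trajectory_join:
  assumes y: "trajectory F t y" and w: "trajectory F u w" and yw: "y t = w 0" and tu: "0 \<le> t" "0 \<le> u"
  shows "trajectory F (t + u) (\<lambda>s. if s \<le> t then y s else w (s - t))" (is "trajectory F _ ?z")
proof -
  obtain N where acy: "absolutely_continuous_arc 0 t y" and N: "negligible N"
    "\<And>s. s \<in> {0<..<t} - N \<Longrightarrow> \<exists>v\<in>F (y s). (y has_vector_derivative v) (at s)"
    using y unfolding trajectory_iff_negligible by blast
  obtain M where acw: "absolutely_continuous_arc 0 u w" and M: "negligible M"
    "\<And>s. s \<in> {0<..<u} - M \<Longrightarrow> \<exists>v\<in>F (w s). (w has_vector_derivative v) (at s)"
    using w unfolding trajectory_iff_negligible by blast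
  \<comment> \<open>The joined arc may have a corner at the junction, so time \<open>t\<close> is
    exceptional as well.\<close>
  let ?N = "N \<union> (+) t ` M \<union> {t}"
  have "\<exists>v\<in>F (?z s). (?z has_vector_derivative v) (at s)" if s: "s \<in> {0<..<t + u} - ?N" for s
  proof (cases "s < t")
    case True
    then obtain v where v: "v \<in> F (y s)" "(y has_vector_derivative v) (at s)"
      using N(2)[of s] s by auto
    have "(?z has_vector_derivative v) (at s)"
      by (rule has_vector_derivative_transform_within_open[OF v(2) open_lessThan[of t]]) (use True in auto)
    then show ?thesis using v True by auto
  next
    case False
    then have "s > t" using s by auto
    have "s - t \<notin> M" using s by (metis DiffD2 UnI1 UnI2 add_diff_cancel_left' diff_add_cancel add.commute image_eqI)
    then obtain v where v: "v \<in> F (w (s - t))" "(w has_vector_derivative v) (at (s - t))"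
      using M(2)[of "s - t"] s \<open>s > t\<close> by auto
    have "((\<lambda>s. w (s - t)) has_vector_derivative v) (at s)"
      using has_vector_derivative_shift[of w v s "- t"] v by simp
    then have "(?z has_vector_derivative v) (at s)"
      by (rule has_vector_derivative_transform_within_open[OF _ open_greaterThan[of t]]) (use \<open>s > t\<close> in auto)
    then show ?thesis using v \<open>s > t\<close> by auto
  qed
  moreover have "negligible ?N" using N(1) M(1) by (simp add: negligible_Un negligible_translation)
  moreover have "absolutely_continuous_arc 0 (t + u) ?z"
    by (rule absolutely_continuous_arc_join[OF acy acw tu yw])
  ultimately show ?thesis unfolding trajectory_iff_negligible by blast
qed

section \<open>Estimates for the minimum time\<close>

lemma min_time_le:
  assumes "trajectory F T y" "y T \<in> \<K>" "0 \<le> T"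
  shows "min_time F \<K> (y 0) \<le> ennreal T"
proof (cases "y 0 \<in> \<K>")
  case False
  then have "T > 0" using assms by (cases "T = 0") auto
  then have "Inf {ennreal T | T. T > 0 \<and> (\<exists>z. trajectory F T z \<and> z 0 = y 0 \<and> z T \<in> \<K>)} \<le> ennreal T"
    using assms by (intro Inf_lower) auto
  then show ?thesis using False by (simp add: min_time_def)
qed (simp add: min_time_def)

text \<open>Dynamic programming: the given piece is followed by a nearly optimal trajectory from its
  endpoint. A endpoint in the target is treated apart, since the minimum time is then zero by
  definition and not an infimum.\<close>

lemma min_time_le_add:
  assumes y: "trajectory F t y" and t: "0 \<le> t"
  shows "min_time F \<K> (y 0) \<le> ennreal t + min_time F \<K> (y t)"
proof (cases "y t \<in> \<K>")
  case True
  then show ?thesis using min_time_le[OF y True t] by (simp add: min_time_def)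
next
  case False
  let ?S = "{ennreal T | T. T > 0 \<and> (\<exists>z. trajectory F T z \<and> z 0 = y t \<and> z T \<in> \<K>)}"
  \<comment> \<open>Strictness fails at infinity; \<open>ennreal_le_epsilon\<close> supplies the
    finiteness.\<close>
  have less: "I < I + ennreal e" if "I < top" "0 < e" for I e
    using that by (cases I rule: ennreal_cases) (auto simp: ennreal_less_iff simp flip: ennreal_plus)
  have "min_time F \<K> (y 0) \<le> ennreal t + Inf ?S"
  proof (rule ennreal_le_epsilon)
    fix e :: real assume "ennreal t + Inf ?S < top" "0 < e"
    then have "Inf ?S < Inf ?S + ennreal e" by (intro less) auto
    then obtain T z where T: "ennreal T < Inf ?S + ennreal e" "T > 0" "trajectory F T z" "z 0 = y t" "z T \<in> \<K>"
      unfolding Inf_less_iff by blast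
    let ?z = "\<lambda>s. if s \<le> t then y s else z (s - t)"
    have "trajectory F (t + T) ?z" using trajectory_join[OF y T(3)] T t by auto
    then have "min_time F \<K> (?z 0) \<le> ennreal (t + T)" by (rule min_time_le) (use T t in auto)
    also have "\<dots> = ennreal t + ennreal T" using T t by (simp add: ennreal_plus)
    also have "\<dots> \<le> ennreal t + (Inf ?S + ennreal e)" using T(1) by (intro add_left_mono less_imp_le)
    finally show "min_time F \<K> (y 0) \<le> ennreal t + Inf ?S + ennreal e" using t by (simp add: add.assoc)
  qed
  then show ?thesis using False by (simp add: min_time_def)
qed

section \<open>Hamiltonian arcs\<close>

lemma absolutely_continuous_arc_exp: "absolutely_continuous_arc a b (\<lambda>s. exp (k * s))"
proof (rule C1_imp_absolutely_continuous_arc)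
  show "((\<lambda>s. exp (k * s)) has_vector_derivative k * exp (k * s)) (at s within {a..b})" for s
    unfolding has_real_derivative_iff_has_vector_derivative[symmetric]
    by (auto intro!: derivative_eq_intros)
qed (intro continuous_intros)

text \<open>The squared norm times \<open>exp (2 * K * s)\<close> is nondecreasing, and times
  \<open>exp (- (2 * K * s))\<close> nonincreasing; squaring avoids the corner of the norm at
  zero.\<close>

lemma absolutely_continuous_arc_gronwall:
  fixes u :: "real \<Rightarrow> 'a::euclidean_space"
  assumes ac: "absolutely_continuous_arc a b u" and N: "negligible N"
    and der: "\<And>s. s \<in> {a<..<b} - N \<Longrightarrow> \<exists>v. (u has_vector_derivative v) (at s) \<and> norm v \<le> K * norm (u s)"
    and st: "s \<in> {a..b}" "t \<in> {a..b}"
  shows "(norm (u s))\<^sup>2 \<le> exp (2 * K * \<bar>t - s\<bar>) * (norm (u t))\<^sup>2"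
proof -
  have ac': "absolutely_continuous_arc a b (\<lambda>s. exp (k * s) * (u s \<bullet> u s))" for k
    using absolutely_continuous_arc_inner[OF absolutely_continuous_arc_exp absolutely_continuous_arc_inner[OF ac ac]]
    by simp
  \<comment> \<open>The sign \<open>\<sigma>\<close> covers both monotonicity statements at
    once.\<close>
  have mono: "\<sigma> * (exp (\<sigma> * (2 * K) * r) * (u r \<bullet> u r)) \<le> \<sigma> * (exp (\<sigma> * (2 * K) * q) * (u q \<bullet> u q))"
    if \<sigma>: "\<sigma> = 1 \<or> \<sigma> = - 1" and rq: "a \<le> r" "r \<le> q" "q \<le> b" for \<sigma> r q
  proof (rule absolutely_continuous_arc_increasing[OF _ N _ rq])
    show "absolutely_continuous_arc a b (\<lambda>r. \<sigma> * (exp (\<sigma> * (2 * K) * r) * (u r \<bullet> u r)))"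
      by (rule absolutely_continuous_arc_dominated1[OF ac'[of "\<sigma> * (2 * K)"], of _ "\<bar>\<sigma>\<bar>"])
         (simp add: abs_mult flip: right_diff_distrib)
    fix r assume "r \<in> {a<..<b} - N"
    then obtain v where v: "(u has_vector_derivative v) (at r)" "norm v \<le> K * norm (u r)"
      using der by blast
    have "((\<lambda>r. u r \<bullet> u r) has_real_derivative 2 * (u r \<bullet> v)) (at r)"
      using v(1) has_derivative_inner[of u _ r UNIV u]
      by (auto simp: has_vector_derivative_def has_field_derivative_def inner_commute algebra_simps
          intro!: derivative_eq_intros)
    then have "((\<lambda>r. \<sigma> * (exp (\<sigma> * (2 * K) * r) * (u r \<bullet> u r))) has_real_derivative
        \<sigma> * (exp (\<sigma> * (2 * K) * r) * (\<sigma> * (2 * K)) * (u r \<bullet> u r) + exp (\<sigma> * (2 * K) * r) * (2 * (u r \<bullet> v)))) (at r)"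
      by (auto intro!: derivative_eq_intros)
    moreover have "\<bar>u r \<bullet> v\<bar> \<le> K * (u r \<bullet> u r)"
    proof -
      have "\<bar>u r \<bullet> v\<bar> \<le> norm (u r) * norm v" by (rule Cauchy_Schwarz_ineq2)
      also have "\<dots> \<le> norm (u r) * (K * norm (u r))" using v(2) by (intro mult_left_mono) auto
      also have "\<dots> = K * (u r \<bullet> u r)" by (simp add: dot_square_norm power2_eq_square)
      finally show ?thesis .
    qed
    then have "0 \<le> exp (\<sigma> * (2 * K) * r) * (2 * (K * (u r \<bullet> u r) + \<sigma> * (u r \<bullet> v)))"
      using \<sigma> by (intro mult_nonneg_nonneg) auto
    then have "0 \<le> \<sigma> * (exp (\<sigma> * (2 * K) * r) * (\<sigma> * (2 * K)) * (u r \<bullet> u r) + exp (\<sigma> * (2 * K) * r) * (2 * (u r \<bullet> v)))"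
      using \<sigma> by (auto simp: algebra_simps)
    ultimately show "\<exists>D\<ge>0. ((\<lambda>r. \<sigma> * (exp (\<sigma> * (2 * K) * r) * (u r \<bullet> u r))) has_real_derivative D) (at r)"
      by blast
  qed
  show ?thesis
  proof (cases "s \<le> t")
    case True
    have "exp (2 * K * s) * (norm (u s))\<^sup>2 \<le> exp (2 * K * t) * (norm (u t))\<^sup>2"
      using mono[of 1 s t] st True by (simp add: power2_norm_eq_inner)
    then show ?thesis using True by (simp add: right_diff_distrib exp_diff field_simps)
  next
    case False
    have "exp (- (2 * K * s)) * (norm (u s))\<^sup>2 \<le> exp (- (2 * K * t)) * (norm (u t))\<^sup>2"
      using mono[of "- 1" t s] st False by (simp add: power2_norm_eq_inner)
    then show ?thesis using False by (simp add: right_diff_distrib exp_diff exp_minus field_simps)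
  qed
qed

text \<open>The constants are those of (F2), (F3), (H1), (H2) on a ball; the arc stays at distance \<open>2\<close> from
  its boundary, which leaves room for the comparison arcs.\<close>

locale hamiltonian_arc =
  fixes F :: "'a::euclidean_space \<Rightarrow> 'a set" and T r L M c K :: real
    and x p :: "real \<Rightarrow> 'a" and N :: "real set"
  assumes F: "F y \<noteq> {}" "compact (F y)"
    and M: "\<And>y v. y \<in> ball 0 r \<Longrightarrow> v \<in> F y \<Longrightarrow> norm v \<le> M"
    and L: "L \<ge> 0" "\<And>y z q. y \<in> ball 0 r \<Longrightarrow> z \<in> ball 0 r \<Longrightarrow>
      max_hamiltonian F y q - max_hamiltonian F z q \<le> L * norm q * norm (z - y)"
    and c: "c \<ge> 0" "\<And>q. semiconvex_on (norm q * c) (ball 0 r) (\<lambda>y. max_hamiltonian F y q)"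
    and differentiable: "\<And>y q. y \<in> ball 0 r \<Longrightarrow> q \<noteq> 0 \<Longrightarrow> max_hamiltonian F y differentiable (at q)"
    and K: "\<And>q. q \<noteq> 0 \<Longrightarrow> K-lipschitz_on (ball 0 r) (\<lambda>y. gradient (max_hamiltonian F y) q)"
    and N: "negligible N"
    and acx: "absolutely_continuous_arc 0 T x" and acp: "absolutely_continuous_arc 0 T p"
    and x_in: "\<And>s. s \<in> {0..T} \<Longrightarrow> norm (x s) < r - 2"
    and dx: "\<And>s. s \<in> {0<..<T} - N \<Longrightarrow>
      (x has_vector_derivative gradient (max_hamiltonian F (x s)) (p s)) (at s)"
    and dp: "\<And>s. s \<in> {0<..<T} - N \<Longrightarrow> \<exists>p'. (p has_vector_derivative p') (at s) \<and>
      - p' \<in> clarke_gradient (\<lambda>y. max_hamiltonian F y (p s)) (x s)"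
begin

abbreviation H :: "'a \<Rightarrow> 'a \<Rightarrow> real" where "H \<equiv> max_hamiltonian F"

abbreviation H\<^sub>p :: "'a \<Rightarrow> 'a \<Rightarrow> 'a" where "H\<^sub>p y q \<equiv> gradient (H y) q"

lemma H\<^sub>p:
  assumes "y \<in> ball 0 r" "q \<noteq> 0"
  shows "H\<^sub>p y q \<in> F y" "H\<^sub>p y q \<bullet> q = H y q"
  using gradient_max_hamiltonian[OF F differentiable[OF assms]] by auto

lemma x_ball: "s \<in> {0..T} \<Longrightarrow> x s \<in> ball 0 r"
  using x_in[of s] by simp

lemma K_nonneg: "0 \<le> K"
proof -
  obtain b :: 'a where "norm b = 1" using vector_choose_size[of 1] by auto
  then have "b \<noteq> 0" by auto
  then show ?thesis using K lipschitz_on_nonneg by blast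
qed

lemma clarke_le:
  assumes "s \<in> {0..T}" "z \<in> ball 0 r" "v \<in> clarke_gradient (\<lambda>y. H y q) (x s)"
  shows "H (x s) q + (z - x s) \<bullet> v \<le> H z q + norm q * c / 2 * (norm (z - x s))\<^sup>2"
  using semiconvex_on_clarke_gradient_le[OF c(2) convex_ball open_ball x_ball[OF assms(1)] assms(2,3)] c(1)
  by simp

text \<open>The Lipschitz bound for the Hamiltonian in the state bounds Clarke gradients, so
  \<open>norm p'\<close> is at most \<open>L * norm p\<close>. Gronwall then spreads a zero both
  ways. Consequently \<open>p 0 \<noteq> 0\<close> keeps the arc where \<open>H\<^sub>p\<close> is
  defined.\<close>

lemma p_zero:
  assumes "s \<in> {0..T}" "t \<in> {0..T}" "p s = 0"
  shows "p t = 0"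
proof -
  have "\<exists>v. (p has_vector_derivative v) (at s) \<and> norm v \<le> L * norm (p s)" if s: "s \<in> {0<..<T} - N" for s
  proof -
    obtain p' where p': "(p has_vector_derivative p') (at s)" "- p' \<in> clarke_gradient (\<lambda>y. H y (p s)) (x s)"
      using dp[OF s] by blast
    have "norm (- p') \<le> L * norm (p s)"
    proof (rule semiconvex_on_clarke_gradient_bound[OF c(2) convex_ball open_ball _ p'(2)])
      show "x s \<in> ball 0 r" using s by (intro x_ball) auto
      then show "H z (p s) - H (x s) (p s) \<le> L * norm (p s) * norm (z - x s)" if "z \<in> ball 0 r" for z
        using L(2)[of z "x s" "p s"] that by (simp add: norm_minus_commute)
    qed (use c L in auto)
    then show ?thesis using p' by auto
  qed
  from absolutely_continuous_arc_gronwall[OF acp N this assms(2,1)] assms(3)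
  show ?thesis by simp
qed

lemma H_const:
  assumes p0: "p 0 \<noteq> 0" and t: "t \<in> {0..T}"
  shows "H (x t) (p t) = H (x 0) (p 0)"
proof -
  define \<phi> where "\<phi> s = H (x s) (p s)" for s
  have p: "p s \<noteq> 0" if "s \<in> {0..T}" for s using p_zero[of s 0] that p0 t by auto
  have "bounded (p ` {0..T})"
    by (intro compact_imp_bounded compact_continuous_image absolutely_continuous_arc_imp_continuous_on acp compact_Icc)
  then obtain B where B: "\<And>s. s \<in> {0..T} \<Longrightarrow> norm (p s) \<le> B" unfolding bounded_iff by blast
  have diff: "\<phi> b - \<phi> a \<le> (L * B) * norm (x b - x a) + M * norm (p b - p a)" if ab: "a \<in> {0..T}" "b \<in> {0..T}" for a b
  proof -
    have "\<phi> b - \<phi> a = (H (x b) (p b) - H (x a) (p b)) + (H (x a) (p b) - H (x a) (p a))" by (simp add: \<phi>_def)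
    also have "\<dots> \<le> L * norm (p b) * norm (x a - x b) + M * norm (p b - p a)"
      using ab x_ball[of a] x_ball[of b]
      by (intro add_mono L(2) max_hamiltonian_lipschitz_right[OF F] M[of "x a"]) auto
    also have "L * norm (p b) * norm (x a - x b) \<le> L * B * norm (x a - x b)"
      using B[OF ab(2)] L by (intro mult_right_mono mult_left_mono) auto
    finally show ?thesis by (simp add: norm_minus_commute)
  qed
  have ac: "absolutely_continuous_arc 0 T \<phi>"
  proof (rule absolutely_continuous_arc_dominated[OF acx acp])
    fix a b assume "a \<in> {0..T}" "b \<in> {0..T}"
    then show "norm (\<phi> b - \<phi> a) \<le> (L * B) * norm (x b - x a) + M * norm (p b - p a)"
      using diff[of a b] diff[of b a] by (auto simp: abs_real_def norm_minus_commute)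
  qed
  have Dini: "\<exists>d>0. \<forall>u. \<bar>u - s\<bar> < d \<longrightarrow> u \<in> {0..T} \<longrightarrow> \<phi> u \<ge> \<phi> s - e * \<bar>u - s\<bar>"
    if s: "s \<in> {0<..<T} - N" and e: "e > 0" for s e
  proof -
    obtain p' where p': "(p has_vector_derivative p') (at s)" "- p' \<in> clarke_gradient (\<lambda>y. H y (p s)) (x s)"
      using dp[OF s] by blast
    define g where "g = H\<^sub>p (x s) (p s)"
    have x': "(x has_vector_derivative g) (at s)" using dx[OF s] by (simp add: g_def)
    have sT: "s \<in> {0..T}" using s by auto
    define C where "C = norm (p s) * c"
    \<comment> \<open>First-order variation of the Hamiltonian minus a quadratic error; inner
      products in place of squared norms keep it easy to differentiate.\<close>
    define \<rho> where "\<rho> u = (g \<bullet> (p u - p s) - p' \<bullet> (x u - x s))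
      - ((K + C) / 2 * ((x u - x s) \<bullet> (x u - x s)) + K / 2 * ((p u - p s) \<bullet> (p u - p s)))" for u
    \<comment> \<open>The maximizer \<open>G\<close> at the new state for the old covector is tested
      against the new covector. It differs from \<open>g\<close> by at most
      \<open>K * norm (x u - x s)\<close>; the mixed term is split into squares, and the Clarke
      inequality treats the change of state.\<close>
    have below: "\<phi> s + \<rho> u \<le> \<phi> u" if u: "u \<in> {0..T}" for u
    proof -
      define G where "G = H\<^sub>p (x u) (p s)"
      have G: "G \<in> F (x u)" "G \<bullet> p s = H (x u) (p s)"
        using H\<^sub>p[OF x_ball[OF u] p[OF sT]] by (auto simp: G_def)
      have "G \<bullet> p u \<le> \<phi> u" unfolding \<phi>_def by (intro max_hamiltonian_upper F G)
      moreover have "G \<bullet> p u - G \<bullet> p s = g \<bullet> (p u - p s) + (G - g) \<bullet> (p u - p s)"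
        by (simp add: algebra_simps)
      moreover have "- ((G - g) \<bullet> (p u - p s)) \<le> K * norm (x u - x s) * norm (p u - p s)"
      proof -
        have "norm (G - g) \<le> K * norm (x u - x s)"
          using lipschitz_onD[OF K[OF p[OF sT]] x_ball[OF u] x_ball[OF sT]] by (simp add: G_def g_def dist_norm)
        then have "norm (G - g) * norm (p u - p s) \<le> K * norm (x u - x s) * norm (p u - p s)"
          by (rule mult_right_mono) auto
        then show ?thesis using Cauchy_Schwarz_ineq2[of "G - g" "p u - p s"] by linarith
      qed
      moreover have "K * norm (x u - x s) * norm (p u - p s) \<le> K / 2 * ((norm (x u - x s))\<^sup>2 + (norm (p u - p s))\<^sup>2)"
        using mult_left_mono[OF sum_squares_bound[of "norm (x u - x s)" "norm (p u - p s)"] K_nonneg] by simp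
      moreover have "H (x s) (p s) + (x u - x s) \<bullet> - p' \<le> H (x u) (p s) + C / 2 * (norm (x u - x s))\<^sup>2"
        using clarke_le[OF sT x_ball[OF u] p'(2)] by (simp add: C_def)
      moreover have "(x u - x s) \<bullet> - p' = - (p' \<bullet> (x u - x s))" by (simp add: inner_commute)
      ultimately have "\<phi> s + (g \<bullet> (p u - p s) - p' \<bullet> (x u - x s)) \<le>
          \<phi> u + (K / 2 * ((norm (x u - x s))\<^sup>2 + (norm (p u - p s))\<^sup>2) + C / 2 * (norm (x u - x s))\<^sup>2)"
        using G(2) unfolding \<phi>_def by linarith
      then show ?thesis by (simp add: \<rho>_def dot_square_norm algebra_simps add_divide_distrib)
    qed
    \<comment> \<open>With \<open>x' = g\<close>, the linear terms cancel as
      \<open>g \<bullet> p' - p' \<bullet> g\<close>, and the quadratic terms have zero derivative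
      at \<open>s\<close>.\<close>
    have "(\<rho> has_real_derivative 0) (at s)"
    proof -
      have "(x has_derivative (\<lambda>h. h *\<^sub>R g)) (at s)" "(p has_derivative (\<lambda>h. h *\<^sub>R p')) (at s)"
        using x' p' by (auto simp: has_vector_derivative_def)
      then have "(\<rho> has_derivative (\<lambda>h. 0)) (at s)"
        unfolding \<rho>_def[abs_def] by (auto intro!: derivative_eq_intros simp: inner_commute)
      then show ?thesis by (simp add: has_field_derivative_def lambda_zero)
    qed
    then have "((\<lambda>h. \<rho> (s + h) / h) \<longlongrightarrow> 0) (at 0)" by (simp add: DERIV_def \<rho>_def)
    then obtain d where d: "d > 0" "\<And>h. h \<noteq> 0 \<Longrightarrow> \<bar>h\<bar> < d \<Longrightarrow> \<bar>\<rho> (s + h) / h\<bar> < e"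
      using e unfolding LIM_eq by (metis diff_zero real_norm_def)
    have "\<phi> u \<ge> \<phi> s - e * \<bar>u - s\<bar>" if u: "\<bar>u - s\<bar> < d" "u \<in> {0..T}" for u
    proof (cases "u = s")
      case False
      then have "\<bar>\<rho> u\<bar> / \<bar>u - s\<bar> < e" using d(2)[of "u - s"] u by simp
      then have "\<bar>\<rho> u\<bar> < e * \<bar>u - s\<bar>" using False by (simp add: pos_divide_less_eq)
      then show ?thesis using below[OF u(2)] by linarith
    qed simp
    then show ?thesis using d(1) by blast
  qed
  have "\<phi> 0 \<le> \<phi> t"
  proof (rule absolutely_continuous_arc_increasing_Dini[where \<phi> = \<phi> and a = 0 and b = t, OF _ _ N])
    show "absolutely_continuous_arc 0 t \<phi>" using t by (intro absolutely_continuous_arc_subinterval[OF ac]) auto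
    fix s e :: real assume se: "s \<in> {0<..<t} - N" "e > 0"
    then obtain d where d: "d > 0" "\<And>u. \<bar>u - s\<bar> < d \<Longrightarrow> u \<in> {0..T} \<Longrightarrow> \<phi> u \<ge> \<phi> s - e * \<bar>u - s\<bar>"
      using Dini[of s e] t by auto
    have "\<phi> s - e * (u - s) \<le> \<phi> u" if "u \<in> {s<..<s + d}" "u \<le> t" for u
      using d(2)[of u] that se t by auto
    then show "\<exists>d>0. \<forall>u\<in>{s<..<s + d}. u \<le> t \<longrightarrow> \<phi> s - e * (u - s) \<le> \<phi> u" using d(1) by blast
  qed (use t in auto)
  moreover have "\<phi> t \<le> \<phi> 0"
  proof (rule absolutely_continuous_arc_decreasing_Dini[where \<phi> = \<phi> and a = 0 and b = t, OF _ _ N])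
    show "absolutely_continuous_arc 0 t \<phi>" using t by (intro absolutely_continuous_arc_subinterval[OF ac]) auto
    fix s e :: real assume se: "s \<in> {0<..<t} - N" "e > 0"
    then obtain d where d: "d > 0" "\<And>u. \<bar>u - s\<bar> < d \<Longrightarrow> u \<in> {0..T} \<Longrightarrow> \<phi> u \<ge> \<phi> s - e * \<bar>u - s\<bar>"
      using Dini[of s e] t by auto
    have "\<phi> s - e * (s - u) \<le> \<phi> u" if "u \<in> {s - d<..<s}" "0 \<le> u" for u
      using d(2)[of u] that se t by auto
    then show "\<exists>d>0. \<forall>u\<in>{s - d<..<s}. 0 \<le> u \<longrightarrow> \<phi> s - e * (s - u) \<le> \<phi> u" using d(1) by blast
  qed (use t in auto)
  ultimately show ?thesis by (simp add: \<phi>_def)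
qed

text \<open>The smallness of \<open>norm (z - x t)\<close> keeps the comparison arc within distance
  one of \<open>x\<close>, hence in the ball where all constants are valid.\<close>

lemma comparison_trajectory:
  assumes p0: "p 0 \<noteq> 0" and t: "t \<in> {0..T}" and z: "exp (K * T) * norm (z - x t) \<le> 1"
    and B: "\<And>s. s \<in> {0..T} \<Longrightarrow> norm (p s) \<le> B"
  obtains y where "trajectory F t y" "y t = z"
    "norm (y 0 - x 0) \<le> exp (K * T) * norm (z - x t)"
    "p 0 \<bullet> (y 0 - x 0) \<le> p t \<bullet> (z - x t) + (B * c / 2 * (exp (K * T))\<^sup>2 * T) * (norm (z - x t))\<^sup>2"
proof -
  define E where "E = exp (K * T)"
  define d where "d = norm (z - x t)"
  have p: "p s \<noteq> 0" if "s \<in> {0..T}" for s using p_zero[of s 0] that p0 t by auto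
  have "norm (x t) < r - 2" using x_in t by blast
  then have r: "r > 2" using norm_ge_zero[of "x t"] by linarith
  \<comment> \<open>Composing with the projection onto a smaller ball makes the right-hand side
    globally Lipschitz with the same constant, since the projection is nonexpansive.\<close>
  define Q :: "'a set" where "Q = cball 0 (r - 1)"
  have Q: "closed Q" "convex Q" "Q \<noteq> {}" using r by (auto simp: Q_def)
  define P where "P = closest_point Q"
  have P: "P y \<in> ball 0 r" for y
    using closest_point_in_set[OF Q(1,3), of y] by (auto simp: P_def Q_def)
  have P_id: "P y = y" if "norm y \<le> r - 1" for y
    unfolding P_def using that by (intro closest_point_self) (simp add: Q_def)
  define G where "G s y = H\<^sub>p (P y) (p s)" for s y
  have lip: "K-lipschitz_on UNIV (G s)" if "s \<in> {0..t}" for s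
  proof (rule lipschitz_onI)
    fix y y'
    have "dist (G s y) (G s y') \<le> K * dist (P y) (P y')"
      unfolding G_def using that t by (intro lipschitz_onD[OF K] p P) auto
    also have "\<dots> \<le> K * dist y y'"
      unfolding P_def using Q by (intro mult_left_mono closest_point_lipschitz K_nonneg) auto
    finally show "dist (G s y) (G s y') \<le> K * dist y y'" .
  qed (rule K_nonneg)
  have cont: "continuous_on {0..t} (\<lambda>s. G s y)" for y
    unfolding G_def
  proof (rule continuous_on_compose2[OF continuous_on_gradient_max_hamiltonian[OF F]])
    show "continuous_on {0..t} p"
      using absolutely_continuous_arc_imp_continuous_on[OF acp] t by (auto intro: continuous_on_subset)
  qed (use p t differentiable[OF P] in auto)
  obtain y where yt: "y t = z" and dy: "\<And>s. s \<in> {0..t} \<Longrightarrow> (y has_vector_derivative G s (y s)) (at s within {0..t})"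
    using ode_terminal_value_exists[OF _ cont lip, of z] t by auto
  have cont_y: "continuous_on {0..t} y"
    using dy has_vector_derivative_continuous by (metis continuous_on_eq_continuous_within)
  have "continuous_on {0..t} (\<lambda>s. (s, y s))" by (intro continuous_intros cont_y)
  from continuous_on_compose2[OF continuous_on_Times_uniformly_lipschitz[OF cont lip] this]
  have "continuous_on {0..t} (\<lambda>s. G s (y s))" by auto
  with dy have acy: "absolutely_continuous_arc 0 t y" by (rule C1_imp_absolutely_continuous_arc)
  have acx': "absolutely_continuous_arc 0 t x" and acp': "absolutely_continuous_arc 0 t p"
    using t by (auto intro: absolutely_continuous_arc_subinterval acx acp)
  have acyx: "absolutely_continuous_arc 0 t (\<lambda>s. y s - x s)"
    by (intro absolutely_continuous_arc_diff acy acx')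
  have dy': "(y has_vector_derivative G s (y s)) (at s)" if "s \<in> {0<..<t}" for s
  proof -
    have "at s within {0..t} = at s" using that by (intro at_within_interior) auto
    then show ?thesis using dy[of s] that by simp
  qed
  have dyx: "((\<lambda>s. y s - x s) has_vector_derivative G s (y s) - H\<^sub>p (x s) (p s)) (at s)"
    if "s \<in> {0<..<t} - N" for s
    using that t by (intro has_vector_derivative_diff dy' dx) auto
  have near: "norm (y s - x s) \<le> E * d" if s: "s \<in> {0..t}" for s
  proof -
    have "(norm (y s - x s))\<^sup>2 \<le> exp (2 * K * \<bar>t - s\<bar>) * (norm (y t - x t))\<^sup>2"
    proof (rule absolutely_continuous_arc_gronwall[OF acyx N])
      fix s assume s: "s \<in> {0<..<t} - N"
      have "G s (x s) = H\<^sub>p (x s) (p s)"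
        unfolding G_def using x_in[of s] s t by (subst P_id) auto
      then have "norm (G s (y s) - H\<^sub>p (x s) (p s)) \<le> K * norm (y s - x s)"
        using lipschitz_onD[OF lip, of s "y s" "x s"] s by (auto simp: dist_norm)
      then show "\<exists>v. ((\<lambda>s. y s - x s) has_vector_derivative v) (at s) \<and> norm v \<le> K * norm (y s - x s)"
        using dyx[OF s] by blast
    qed (use s t in auto)
    also have "\<dots> \<le> exp (2 * K * T) * d\<^sup>2"
      using s t K_nonneg by (auto simp: yt d_def intro!: mult_left_mono mult_right_mono)
    also have "\<dots> = (E * d)\<^sup>2"
      by (simp add: E_def power_mult_distrib power2_eq_square mult.assoc flip: exp_add)
    finally show ?thesis by (rule power2_le_imp_le) (simp add: E_def d_def)
  qed
  \<comment> \<open>The arc stays in \<open>Q\<close>, so the projection acts as the identity along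
    it and \<open>y\<close> solves the original equation.\<close>
  have y_in: "norm (y s) \<le> r - 1" if "s \<in> {0..t}" for s
  proof -
    have "norm (y s) \<le> norm (x s) + norm (y s - x s)" using norm_triangle_sub by blast
    then show ?thesis using near[OF that] x_in[of s] that t z by (auto simp: E_def d_def)
  qed
  have Gy: "G s (y s) \<in> F (y s)" "G s (y s) \<bullet> p s = H (y s) (p s)" if "s \<in> {0..t}" for s
    using H\<^sub>p[of "y s" "p s"] P_id[OF y_in[OF that]] y_in[OF that] p[of s] that t by (auto simp: G_def)
  \<comment> \<open>A bound, uniform in time, for the semiconvexity error along the arc; adding
    \<open>A * s\<close> makes \<open>\<psi>\<close> nondecreasing.\<close>
  define A where "A = B * c / 2 * E\<^sup>2 * d\<^sup>2"
  have B0: "0 \<le> B" using B[OF t] norm_ge_zero[of "p t"] by linarith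
  define \<psi> where "\<psi> s = p s \<bullet> (y s - x s) + A * s" for s
  have "\<psi> 0 \<le> \<psi> t"
  proof (rule absolutely_continuous_arc_increasing[where \<phi> = \<psi> and a = 0 and b = t, OF _ N])
    have "absolutely_continuous_arc 0 t (\<lambda>s. A * s)"
      by (rule absolutely_continuous_arc_dominated1[OF absolutely_continuous_arc_ident, of _ _ _ "\<bar>A\<bar>"])
         (simp add: abs_mult flip: right_diff_distrib)
    then show "absolutely_continuous_arc 0 t \<psi>"
      unfolding \<psi>_def[abs_def] by (intro absolutely_continuous_arc_add absolutely_continuous_arc_inner acp' acyx)
    fix s assume s: "s \<in> {0<..<t} - N"
    then have sT: "s \<in> {0..T}" and st: "s \<in> {0..t}" and s': "s \<in> {0<..<T} - N" using t by auto
    obtain p' where p': "(p has_vector_derivative p') (at s)" "- p' \<in> clarke_gradient (\<lambda>y. H y (p s)) (x s)"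
      using dp[OF s'] by blast
    let ?v = "G s (y s) - H\<^sub>p (x s) (p s)"
    have "(p has_derivative (\<lambda>h. h *\<^sub>R p')) (at s)" "((\<lambda>s. y s - x s) has_derivative (\<lambda>h. h *\<^sub>R ?v)) (at s)"
      using p' dyx[OF s] by (auto simp: has_vector_derivative_def)
    from has_derivative_inner[OF this]
    have "((\<lambda>s. p s \<bullet> (y s - x s)) has_real_derivative (p s \<bullet> ?v + p' \<bullet> (y s - x s))) (at s)"
      unfolding has_field_derivative_def by (rule has_derivative_eq_rhs) (auto simp: algebra_simps)
    then have "(\<psi> has_real_derivative (p s \<bullet> ?v + p' \<bullet> (y s - x s) + A)) (at s)"
      unfolding \<psi>_def[abs_def] by (auto intro!: derivative_eq_intros)
    moreover have "0 \<le> p s \<bullet> ?v + p' \<bullet> (y s - x s) + A"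
    proof -
      have "H (x s) (p s) + (y s - x s) \<bullet> - p' \<le> H (y s) (p s) + norm (p s) * c / 2 * (norm (y s - x s))\<^sup>2"
        using y_in[OF st] by (intro clarke_le sT p') auto
      also have "norm (p s) * c / 2 * (norm (y s - x s))\<^sup>2 \<le> B * c / 2 * (E * d)\<^sup>2"
        using B[OF sT] near[OF st] c(1) B0 by (intro mult_mono divide_right_mono power_mono) auto
      also have "\<dots> = A" by (simp add: A_def power_mult_distrib)
      finally show ?thesis
        using Gy(2)[OF st] H\<^sub>p(2)[OF x_ball[OF sT] p[OF sT]] by (simp add: inner_diff_right inner_commute)
    qed
    ultimately show "\<exists>D\<ge>0. (\<psi> has_real_derivative D) (at s)" by blast
  qed (use t in auto)
  moreover have "A * t \<le> (B * c / 2 * E\<^sup>2 * T) * d\<^sup>2"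
  proof -
    have "A * t \<le> A * T" using t B0 c(1) by (intro mult_left_mono) (auto simp: A_def)
    then show ?thesis by (simp add: A_def mult_ac)
  qed
  ultimately have "p 0 \<bullet> (y 0 - x 0) \<le> p t \<bullet> (z - x t) + (B * c / 2 * E\<^sup>2 * T) * d\<^sup>2"
    by (simp add: \<psi>_def yt)
  moreover have "norm (y 0 - x 0) \<le> E * d" using near[of 0] t by auto
  moreover have "trajectory F t y"
    unfolding trajectory_iff_negligible
  proof (intro conjI exI[of _ N] ballI acy N)
    fix s assume "s \<in> {0<..<t} - N"
    then show "\<exists>v\<in>F (y s). (y has_vector_derivative v) (at s)"
      using dy'[of s] Gy(1)[of s] by auto
  qed
  ultimately show thesis using that[of y] yt by (simp add: E_def d_def)
qed

end

section \<open>Propagation of proximal normals and conservation of the Hamiltonian\<close>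

theorem theorem4p6:
  fixes F :: "real ^ 'n \<Rightarrow> (real ^ 'n) set"
    and \<K> :: "(real ^ 'n) set"
    and x\<^sub>0 :: "real ^ 'n"
    and x p :: "real \<Rightarrow> real ^ 'n"
  assumes "assumption_F F"
    and "assumption_H F"
    and "closed \<K>"
    and "x\<^sub>0 \<in> controllable_set F \<K> - \<K>"
    and "optimal_trajectory F \<K> x\<^sub>0 x"
    and "absolutely_continuous_arc 0 (enn2real (min_time F \<K> x\<^sub>0)) p"
    and "hamiltonian_system_solution F (enn2real (min_time F \<K> x\<^sub>0)) x p"
    and "x 0 = x\<^sub>0"
    and "- p 0 \<in> proximal_normal_cone (reachable_set F \<K> (min_time F \<K> x\<^sub>0)) x\<^sub>0"
  shows "\<forall>t\<in>{0..enn2real (min_time F \<K> x\<^sub>0)}.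
           - p t \<in> proximal_normal_cone (reachable_set F \<K> (min_time F \<K> (x t))) (x t) \<and>
           min_hamiltonian F (x t) (- p t) = min_hamiltonian F x\<^sub>0 (- p 0)"
proof
  define \<tau> where "\<tau> = enn2real (min_time F \<K> x\<^sub>0)"
  fix t assume "t \<in> {0..enn2real (min_time F \<K> x\<^sub>0)}"
  then have t: "t \<in> {0..\<tau>}" by (simp add: \<tau>_def)
  have \<tau>: "ennreal \<tau> = min_time F \<K> x\<^sub>0"
    using assms(4) by (simp add: \<tau>_def controllable_set_def)
  have traj: "trajectory F \<tau> x" "x \<tau> \<in> \<K>"
    using assms(5) by (simp_all add: optimal_trajectory_def \<tau>_def)
  have acx: "absolutely_continuous_arc 0 \<tau> x" and acp: "absolutely_continuous_arc 0 \<tau> p"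
    using assms(7) by (simp_all add: hamiltonian_system_solution_def \<tau>_def)
  have F: "F y \<noteq> {}" "compact (F y)" for y
    using assms(1) by (simp_all add: assumption_F_def)
  have "bounded (x ` {0..\<tau>})" "bounded (p ` {0..\<tau>})"
    by (intro compact_imp_bounded compact_continuous_image absolutely_continuous_arc_imp_continuous_on acx acp compact_Icc)+
  then obtain R B where R: "\<And>s. s \<in> {0..\<tau>} \<Longrightarrow> norm (x s) \<le> R" and B: "\<And>s. s \<in> {0..\<tau>} \<Longrightarrow> norm (p s) \<le> B"
    unfolding bounded_iff by blast
  have R0: "0 \<le> R" and B0: "0 \<le> B" using R[OF t] B[OF t] norm_ge_zero[of "x t"] norm_ge_zero[of "p t"] by linarith+
  \<comment> \<open>The arc has norm at most \<open>R\<close>, which is strictly less than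
    \<open>r - 2\<close> as the locale demands.\<close>
  define r where "r = R + 3"
  have r: "r > 0" using R0 by (simp add: r_def)
  note F23 = conjunct2[OF assms(1)[unfolded assumption_F_def]]
  obtain \<gamma> where \<gamma>: "\<gamma> > 0" "\<forall>y. \<forall>v\<in>F y. norm v \<le> \<gamma> * (1 + norm y)"
    using conjunct2[OF F23] by blast
  obtain L where L: "L > 0" "\<forall>y\<in>cball 0 r. \<forall>z\<in>cball 0 r.
      F y \<subseteq> {w + (L * norm (z - y)) *\<^sub>R b | w b. w \<in> F z \<and> b \<in> cball 0 1}"
    using mp[OF spec[OF conjunct1[OF F23]] compact_cball[of 0 r]] by (elim exE conjE)
  note Hr = mp[OF spec[OF assms(2)[unfolded assumption_H_def]] r]
  obtain c where c: "c \<ge> 0" "\<forall>q\<in>sphere 0 1. semiconvex_on c (ball 0 r) (\<lambda>y. max_hamiltonian F y q)"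
    using conjunct1[OF Hr] by (elim exE conjE)
  note differentiable = conjunct1[OF conjunct2[OF Hr]]
  obtain K where K: "\<forall>q. q \<noteq> 0 \<longrightarrow> K-lipschitz_on (ball 0 r) (\<lambda>y. gradient (max_hamiltonian F y) q)"
    using conjunct2[OF conjunct2[OF Hr]] by (elim exE)
  define sol where "sol s \<longleftrightarrow>
        max_hamiltonian F (x s) differentiable (at (p s)) \<and>
        (x has_vector_derivative gradient (max_hamiltonian F (x s)) (p s)) (at s within {0..\<tau>}) \<and>
        (\<exists>p'. (p has_vector_derivative p') (at s within {0..\<tau>}) \<and>
           - p' \<in> clarke_gradient (\<lambda>y. max_hamiltonian F y (p s)) (x s))" for s
  have "AE s in lebesgue_on {0..\<tau>}. sol s"
    using assms(7) unfolding hamiltonian_system_solution_def sol_def \<tau>_def by (elim conjE)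
  from AE_lebesgue_on_imp_negligible[OF this]
  obtain N where N: "negligible N" "\<forall>s\<in>{0..\<tau>} - N. sol s" by (elim exE conjE)
  have interior: "s \<in> {0..\<tau>} - N \<and> at s within {0..\<tau>} = at s" if "s \<in> {0<..<\<tau>} - N" for s
    using that by (auto intro!: at_within_interior)
  interpret hamiltonian_arc F \<tau> r L "\<gamma> * (1 + r)" c K x p N
  proof
    fix y v assume y: "y \<in> ball 0 r" and v: "v \<in> F y"
    have "\<gamma> * (1 + norm y) \<le> \<gamma> * (1 + r)" using \<gamma>(1) y by (intro mult_left_mono) auto
    then show "norm v \<le> \<gamma> * (1 + r)" using bspec[OF spec[OF \<gamma>(2)] v] by linarith
  next
    fix y z q :: "real ^ 'n" assume "y \<in> ball 0 r" "z \<in> ball 0 r"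
    then have "y \<in> cball 0 r" "z \<in> cball 0 r" by auto
    from max_hamiltonian_lipschitz_left[OF F F(2) bspec[OF bspec[OF L(2) this(1)] this(2)]] L(1)
    show "max_hamiltonian F y q - max_hamiltonian F z q \<le> L * norm q * norm (z - y)" by simp
  next
    show "semiconvex_on (norm q * c) (ball 0 r) (\<lambda>y. max_hamiltonian F y q)" for q
      by (rule semiconvex_on_max_hamiltonian[OF _ bspec[OF c(2)]]) (use F in auto)
  next
    fix s assume "s \<in> {0..\<tau>}"
    then show "norm (x s) < r - 2" using R[of s] by (simp add: r_def)
  next
    fix s assume "s \<in> {0<..<\<tau>} - N"
    then have "sol s" "at s within {0..\<tau>} = at s" using bspec[OF N(2), of s] interior[of s] by blast+
    then show "(x has_vector_derivative gradient (max_hamiltonian F (x s)) (p s)) (at s)"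
      "\<exists>p'. (p has_vector_derivative p') (at s) \<and> - p' \<in> clarke_gradient (\<lambda>y. max_hamiltonian F y (p s)) (x s)"
      unfolding sol_def by simp_all
  qed (use F L(1) c(1) differentiable K N(1) acx acp in auto)
  show "- p t \<in> proximal_normal_cone (reachable_set F \<K> (min_time F \<K> (x t))) (x t) \<and>
           min_hamiltonian F (x t) (- p t) = min_hamiltonian F x\<^sub>0 (- p 0)"
  proof (cases "p 0 = 0")
    case True
    then have "p t = 0" using p_zero[of 0 t] t by simp
    moreover have "max_hamiltonian F y 0 = 0" for y
      using max_hamiltonian_scaleR[OF F, where a = 0 and p = 0] by simp
    ultimately show ?thesis
      using True min_hamiltonian_uminus[OF F, where p = 0] by (auto simp: proximal_normal_cone_def)
  next
    case False
    have "min_hamiltonian F (x t) (- p t) = min_hamiltonian F x\<^sub>0 (- p 0)"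
      using H_const[OF False t] assms(8) by (simp add: min_hamiltonian_uminus F)
    moreover have "- p t \<in> proximal_normal_cone (reachable_set F \<K> (min_time F \<K> (x t))) (x t)"
    proof -
      obtain \<sigma> where \<sigma>: "\<sigma> \<ge> 0" "\<And>y. min_time F \<K> y \<le> min_time F \<K> x\<^sub>0 \<Longrightarrow> - p 0 \<bullet> (y - x 0) \<le> \<sigma> * (norm (y - x 0))\<^sup>2"
        using assms(8,9) by (auto simp: proximal_normal_cone_def reachable_set_def)
      \<comment> \<open>\<open>E\<close> and \<open>C\<close> are the constants of
        \<open>comparison_trajectory\<close>.\<close>
      define E where "E = exp (K * \<tau>)"
      define C where "C = B * c / 2 * E\<^sup>2 * \<tau>"
      have C0: "0 \<le> C" using B0 c(1) t by (simp add: C_def)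
      have E0: "0 < E" by (simp add: E_def)
      have "min_time F \<K> (x (0 + t)) \<le> ennreal (\<tau> - t)"
        by (rule min_time_le[OF trajectory_suffix[OF traj(1)]]) (use t traj(2) in auto)
      then have xt: "min_time F \<K> (x t) \<le> ennreal (\<tau> - t)" by simp
      \<comment> \<open>Points near \<open>x t\<close> need the coefficient
        \<open>\<sigma> * E\<^sup>2 + C\<close>; the summand \<open>B * E\<close> serves the distant
        ones.\<close>
      have "- p t \<bullet> (z - x t) \<le> (\<sigma> * E\<^sup>2 + C + B * E) * (norm (z - x t))\<^sup>2"
        if z: "min_time F \<K> z \<le> min_time F \<K> (x t)" for z
      proof (cases "E * norm (z - x t) \<le> 1")
        case True
        obtain y where y: "trajectory F t y" "y t = z" "norm (y 0 - x 0) \<le> E * norm (z - x t)"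
          "p 0 \<bullet> (y 0 - x 0) \<le> p t \<bullet> (z - x t) + C * (norm (z - x t))\<^sup>2"
          using comparison_trajectory[OF False t True[unfolded E_def] B] unfolding E_def C_def by blast
        have "min_time F \<K> (y 0) \<le> ennreal t + min_time F \<K> z"
          using min_time_le_add[OF y(1)] t y(2) by auto
        also have "\<dots> \<le> ennreal t + ennreal (\<tau> - t)" using z xt by (intro add_left_mono) simp
        \<comment> \<open>The two durations add up to exactly the minimum time of the initial point,
          so the proximal inequality at time zero applies to \<open>y 0\<close>.\<close>
        also have "\<dots> = min_time F \<K> x\<^sub>0" using t by (simp add: \<tau>[symmetric] flip: ennreal_plus)
        finally have "- p 0 \<bullet> (y 0 - x 0) \<le> \<sigma> * (norm (y 0 - x 0))\<^sup>2" by (rule \<sigma>(2))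
        also have "\<dots> \<le> \<sigma> * (E * norm (z - x t))\<^sup>2"
          using y(3) \<sigma>(1) by (intro mult_left_mono power_mono) auto
        finally have "- p t \<bullet> (z - x t) \<le> (\<sigma> * E\<^sup>2 + C) * (norm (z - x t))\<^sup>2"
          using y(4) by (simp add: power_mult_distrib algebra_simps)
        also have "\<dots> \<le> (\<sigma> * E\<^sup>2 + C + B * E) * (norm (z - x t))\<^sup>2"
          using B0 E0 by (intro mult_right_mono) auto
        finally show ?thesis .
      next
        case False
        have "- p t \<bullet> (z - x t) \<le> norm (p t) * norm (z - x t)"
          using norm_cauchy_schwarz[of "- p t" "z - x t"] by simp
        also have "\<dots> \<le> B * norm (z - x t) * 1" using B[OF t] by (simp add: mult_right_mono)
        \<comment> \<open>For a distant point the factor \<open>E * norm (z - x t)\<close> exceeds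
          one, which turns the linear bound into a quadratic one.\<close>
        also have "\<dots> \<le> B * norm (z - x t) * (E * norm (z - x t))"
          using False B0 by (intro mult_left_mono) auto
        also have "\<dots> = B * E * (norm (z - x t))\<^sup>2" by (simp add: power2_eq_square)
        also have "\<dots> \<le> (\<sigma> * E\<^sup>2 + C + B * E) * (norm (z - x t))\<^sup>2"
          using \<sigma>(1) C0 by (intro mult_right_mono) auto
        finally show ?thesis .
      qed
      moreover have "0 \<le> \<sigma> * E\<^sup>2 + C + B * E" using \<sigma>(1) C0 B0 E0 by simp
      ultimately show ?thesis by (auto simp: proximal_normal_cone_def reachable_set_def)
    qed
    ultimately show ?thesis by blast
  qed
qed

end
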